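(* Let $F:\mathcal{D}(F)\subseteq L^2(\Omega_X)\to L^2(\Omega_Y)$ be weakly sequentially closed, continuous, and Fréchet differentiable with Lipschitz continuous derivative in $\mathcal{B}_r^{L^2}(x^\dagger)$, i.e. there is $L_1>0$ with $\|F'[x]-F'[x^\dagger]\|\le L_1\|x-x^\dagger\|_{L^2(\Omega_X)}$ for all $x\in\mathcal{B}_r^{L^2}(x^\dagger)$. Moreover, suppose that for every $\xi>0$, $M_\xi(\mathcal{D}(F))\subseteq\mathcal{D}(F)$ and $M_\xi(\mathcal{D}(F))$ is compact in $C(\overline{\Omega_X})$. Let $\xi^\dagger>0$ be such that $x^\dagger_\xi\in\mathcal{B}^{L^2}_{r/2}(x^\dagger)$ for all $0<\xi\le\xi^\dagger$. Then for every $0<\xi\le\xi^\dagger$ and every $\varepsilon>0$ there exist a number $\mathtt n(\xi,\varepsilon)\in\mathbb{N}$ and a coefficient vector $\mathcal{T}_{\mathtt n(\xi,\varepsilon)}$ with associated neural operator $F_{\mathtt n(\xi,\varepsilon)}$ such that $$\|F[x]-F_{\mathtt n(\xi,\varepsilon)}[x_\xi]\|_{L^2(\Omega_Y)}\le\varepsilon+L_0\|x-x_\xi\|_{L^2(\Omega_X)}\qquad\text{for all }x\in\mathcal{B}^{L^2}_{r/2}(x^\dagger),$$ where $L_0:=\|F'[x^\dagger]\|+L_1r$ (a Lipschitz constant of $F$ in $\mathcal{B}_r^{L^2}(x^\dagger)$).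
   Context: $\Omega_X\subseteq\mathbb{R}^m$ and $\Omega_Y\subseteq\mathbb{R}^n$ are bounded domains with piecewise smooth boundaries satisfying the cone property. $C(\overline{\Omega_X})$ carries the norm $\|\cdot\|_{L^\infty(\Omega_X)}$. $x^{(0)}\in\mathcal{D}(F)$ is fixed, $y\in L^2(\Omega_Y)$ is such that $F[x]=y$ is solvable, and $x^\dagger\in\mathcal{D}(F)$ is an $x^{(0)}$-minimum-norm solution (a solution of $F[x]=y$ minimizing $\|x-x^{(0)}\|_{L^2(\Omega_X)}$ among all solutions in $\mathcal{D}(F)$). $\mathcal{B}_r^{L^2}(x^\dagger)$ is the open ball in $L^2(\Omega_X)$ of radius $r$ around $x^\dagger$; it is assumed that $\mathcal{B}_r^{L^2}(x^\dagger)\subseteq\mathcal{D}(F)$ and $r>2\|x^\dagger-x^{(0)}\|_{L^2(\Omega_X)}$. Weakly sequentially closed means: if $x_k\in\mathcal{D}(F)$, $x_k\rightharpoonup x$ in $L^2(\Omega_X)$ and $F[x_k]\rightharpoonup z$ in $L^2(\Omega_Y)$, then $x\in\mathcal{D}(F)$ and $F[x]=z$. Mollification: let $\phi(\vec s)=C\exp\big(1/(|\vec s|^2-1)\big)$ for $|\vec s|<1$ and $0$ otherwise, $\vec s\in\mathbb{R}^m$, with $C>0$ such that $\int_{\mathbb{R}^m}\phi=1$, and $\phi_\xi(\vec s)=\xi^{-m}\phi(\vec s/\xi)$ for $\xi>0$. For $x\in L^2(\Omega_X)$, extended by zero to $\mathbb{R}^m$, set $x_\xi:=M_\xi x:=\phi_\xi*x$,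 regarded as an element of $C(\overline{\Omega_X})$. Sigmoid function: $\sigma:\mathbb{R}\to\mathbb{R}$ strictly increasing, differentiable, with limits $1$ at $+\infty$ and $0$ at $-\infty$; one such $\sigma$ is fixed. Neural operator: for a coefficient vector $\mathcal{T}_{\mathtt n}=(\alpha_{j,k},w_{j,k,l},\vec w_j,\theta_{j,k},\vec s_l,\zeta_j)_{j\le J,k\le K,l\le L}$ with $\alpha_{j,k},w_{j,k,l},\theta_{j,k},\zeta_j\in\mathbb{R}$, $\vec w_j\in\mathbb{R}^n$, $\vec s_l\in\Omega_X$, of size $\mathtt n=J(K(L+2)+n+1)+Lm$, the associated neural operator, acting on continuous functions $x\in C(\overline{\Omega_X})$, is $$F_{\mathtt n}[x](\vec t)=\sum_{j=1}^{J}\sum_{k=1}^{K}\alpha_{j,k}\,\sigma\Big(\sum_{l=1}^{L}w_{j,k,l}\,x(\vec s_l)+\theta_{j,k}\Big)\sigma(\vec w_j^{T}\vec t+\zeta_j),\quad \vec t\in\Omega_Y,$$ with coefficients not depending on $x$. *)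

theory Defs
  imports "HOL-Analysis.Analysis"
begin

section \<open>Domains\<close>

text \<open>
  A finite cone with vertex at the origin is the intersection of an open ball around the
  origin with the union of all open rays through an open ball that does not contain the
  origin. The cone property asks for congruent copies of one such cone; congruence is spelled
  out through rigid motions (reflections do no harm, since the cone is rotationally symmetric).
\<close>

definition finite_cone :: "'a::euclidean_space set \<Rightarrow> bool" where
  "finite_cone C \<longleftrightarrow> (\<exists>c \<rho> h. 0 < \<rho> \<and> 0 < h \<and> 0 \<notin> ball c \<rho> \<and>
     C = ball 0 h \<inter> {t *\<^sub>R z | t z. 0 < t \<and> z \<in> ball c \<rho>})"

definition cone_property :: "'a::euclidean_space set \<Rightarrow> bool" where
  "cone_property \<Omega> \<longleftrightarrow> (\<exists>C::'a set. finite_cone C \<and>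
     (\<forall>p\<in>\<Omega>. \<exists>R. orthogonal_transformation R \<and> (\<lambda>z. p + R z) ` C \<subseteq> \<Omega>))"

text \<open>
  Smooth means continuously differentiable, as for \<open>valid_path\<close>: a smooth hypersurface is
  locally the zero set of a \<open>C\<^sup>1\<close> function without critical points. In dimension one
  this is a set of isolated points.
\<close>

definition smooth_hypersurface :: "'a::euclidean_space set \<Rightarrow> bool" where
  "smooth_hypersurface S \<longleftrightarrow> (\<forall>p\<in>S. \<exists>U g grad. open U \<and> p \<in> U \<and>
     continuous_on U grad \<and>
     (\<forall>q\<in>U. (g has_derivative (\<lambda>v. grad q \<bullet> v)) (at q) \<and> grad q \<noteq> 0) \<and>
     S \<inter> U = {q\<in>U. g q = (0::real)})"

text \<open>
  The boundary consists of the closures of finitely many relatively open smooth pieces, each of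
  which extends smoothly beyond its edges.
\<close>

definition piecewise_smooth_boundary :: "'a::euclidean_space set \<Rightarrow> bool" where
  "piecewise_smooth_boundary \<Omega> \<longleftrightarrow> (\<exists>\<S>. finite \<S> \<and>
     frontier \<Omega> = (\<Union>S\<in>\<S>. closure S) \<and>
     (\<forall>S\<in>\<S>. openin (top_of_set (frontier \<Omega>)) S \<and> smooth_hypersurface S \<and>
       (\<exists>S'. smooth_hypersurface S' \<and> closure S \<subseteq> S')))"

definition regular_bounded_domain :: "'a::euclidean_space set \<Rightarrow> bool" where
  "regular_bounded_domain \<Omega> \<longleftrightarrow> open \<Omega> \<and> connected \<Omega> \<and> \<Omega> \<noteq> {} \<and> bounded \<Omega> \<and>
     piecewise_smooth_boundary \<Omega> \<and> cone_property \<Omega>"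

section \<open>The space \<open>L\<^sup>2(\<Omega>)\<close>\<close>

text \<open>
  Elements of \<open>L\<^sup>2(\<Omega>)\<close> are represented by functions on the whole space, of which only the
  values on \<open>\<Omega>\<close> matter. Equality in \<open>L\<^sup>2(\<Omega>)\<close> is the relation \<open>L2_eq\<close>, and everything
  below respects it. In particular, subsets of \<open>L\<^sup>2(\<Omega>)\<close> are sets of representatives closed
  under \<open>L2_eq\<close>, and operators map equal arguments to equal values.
\<close>

definition L2 :: "'a::euclidean_space set \<Rightarrow> ('a \<Rightarrow> real) set" where
  "L2 \<Omega> = {f. f \<in> borel_measurable (lebesgue_on \<Omega>) \<and> integrable (lebesgue_on \<Omega>) (\<lambda>s. (f s)\<^sup>2)}"

definition L2_eq :: "'a::euclidean_space set \<Rightarrow> ('a \<Rightarrow> real) \<Rightarrow> ('a \<Rightarrow> real) \<Rightarrow> bool" where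
  "L2_eq \<Omega> f g \<longleftrightarrow> (AE s in lebesgue_on \<Omega>. f s = g s)"

definition L2_norm :: "'a::euclidean_space set \<Rightarrow> ('a \<Rightarrow> real) \<Rightarrow> real" where
  "L2_norm \<Omega> f = sqrt (\<integral>s. (f s)\<^sup>2 \<partial>lebesgue_on \<Omega>)"

definition L2_dist :: "'a::euclidean_space set \<Rightarrow> ('a \<Rightarrow> real) \<Rightarrow> ('a \<Rightarrow> real) \<Rightarrow> real" where
  "L2_dist \<Omega> f g = L2_norm \<Omega> (\<lambda>s. f s - g s)"

definition L2_ball :: "'a::euclidean_space set \<Rightarrow> ('a \<Rightarrow> real) \<Rightarrow> real \<Rightarrow> ('a \<Rightarrow> real) set" where
  "L2_ball \<Omega> c r = {f \<in> L2 \<Omega>. L2_dist \<Omega> f c < r}"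

definition L2_subset :: "'a::euclidean_space set \<Rightarrow> ('a \<Rightarrow> real) set \<Rightarrow> bool" where
  "L2_subset \<Omega> D \<longleftrightarrow> D \<subseteq> L2 \<Omega> \<and> (\<forall>f\<in>D. \<forall>g\<in>L2 \<Omega>. L2_eq \<Omega> f g \<longrightarrow> g \<in> D)"

text \<open>Weak convergence is convergence under every bounded linear functional.\<close>

definition L2_functional :: "'a::euclidean_space set \<Rightarrow> (('a \<Rightarrow> real) \<Rightarrow> real) \<Rightarrow> bool" where
  "L2_functional \<Omega> \<phi> \<longleftrightarrow>
     (\<forall>f\<in>L2 \<Omega>. \<forall>g\<in>L2 \<Omega>. \<phi> (\<lambda>s. f s + g s) = \<phi> f + \<phi> g) \<and>
     (\<forall>c. \<forall>f\<in>L2 \<Omega>. \<phi> (\<lambda>s. c * f s) = c * \<phi> f) \<and>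
     (\<exists>B. \<forall>f\<in>L2 \<Omega>. \<bar>\<phi> f\<bar> \<le> B * L2_norm \<Omega> f)"

definition L2_weak_limit ::
    "'a::euclidean_space set \<Rightarrow> (nat \<Rightarrow> 'a \<Rightarrow> real) \<Rightarrow> ('a \<Rightarrow> real) \<Rightarrow> bool" where
  "L2_weak_limit \<Omega> X x \<longleftrightarrow> (\<forall>\<phi>. L2_functional \<Omega> \<phi> \<longrightarrow> (\<lambda>k. \<phi> (X k)) \<longlonglongrightarrow> \<phi> x)"

section \<open>Operators between \<open>L\<^sup>2\<close> spaces\<close>

definition L2_operator :: "'a::euclidean_space set \<Rightarrow> 'b::euclidean_space set \<Rightarrow>
    ('a \<Rightarrow> real) set \<Rightarrow> (('a \<Rightarrow> real) \<Rightarrow> ('b \<Rightarrow> real)) \<Rightarrow> bool" where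
  "L2_operator \<Omega>\<^sub>X \<Omega>\<^sub>Y D F \<longleftrightarrow> L2_subset \<Omega>\<^sub>X D \<and> F ` D \<subseteq> L2 \<Omega>\<^sub>Y \<and>
     (\<forall>f\<in>D. \<forall>g\<in>D. L2_eq \<Omega>\<^sub>X f g \<longrightarrow> L2_eq \<Omega>\<^sub>Y (F f) (F g))"

definition L2_weakly_seq_closed :: "'a::euclidean_space set \<Rightarrow> 'b::euclidean_space set \<Rightarrow>
    ('a \<Rightarrow> real) set \<Rightarrow> (('a \<Rightarrow> real) \<Rightarrow> ('b \<Rightarrow> real)) \<Rightarrow> bool" where
  "L2_weakly_seq_closed \<Omega>\<^sub>X \<Omega>\<^sub>Y D F \<longleftrightarrow>
     (\<forall>X. \<forall>x\<in>L2 \<Omega>\<^sub>X. \<forall>z\<in>L2 \<Omega>\<^sub>Y.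
        (\<forall>k. X k \<in> D) \<and> L2_weak_limit \<Omega>\<^sub>X X x \<and> L2_weak_limit \<Omega>\<^sub>Y (\<lambda>k. F (X k)) z
        \<longrightarrow> x \<in> D \<and> L2_eq \<Omega>\<^sub>Y (F x) z)"

definition L2_continuous_on :: "'a::euclidean_space set \<Rightarrow> 'b::euclidean_space set \<Rightarrow>
    ('a \<Rightarrow> real) set \<Rightarrow> (('a \<Rightarrow> real) \<Rightarrow> ('b \<Rightarrow> real)) \<Rightarrow> bool" where
  "L2_continuous_on \<Omega>\<^sub>X \<Omega>\<^sub>Y D F \<longleftrightarrow>
     (\<forall>x\<in>D. \<forall>e>0. \<exists>d>0. \<forall>x'\<in>D. L2_dist \<Omega>\<^sub>X x' x < d \<longrightarrow> L2_dist \<Omega>\<^sub>Y (F x') (F x) < e)"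

definition L2_bounded_linear :: "'a::euclidean_space set \<Rightarrow> 'b::euclidean_space set \<Rightarrow>
    (('a \<Rightarrow> real) \<Rightarrow> ('b \<Rightarrow> real)) \<Rightarrow> bool" where
  "L2_bounded_linear \<Omega>\<^sub>X \<Omega>\<^sub>Y A \<longleftrightarrow> L2_operator \<Omega>\<^sub>X \<Omega>\<^sub>Y (L2 \<Omega>\<^sub>X) A \<and>
     (\<forall>f\<in>L2 \<Omega>\<^sub>X. \<forall>g\<in>L2 \<Omega>\<^sub>X. L2_eq \<Omega>\<^sub>Y (A (\<lambda>s. f s + g s)) (\<lambda>t. A f t + A g t)) \<and>
     (\<forall>c. \<forall>f\<in>L2 \<Omega>\<^sub>X. L2_eq \<Omega>\<^sub>Y (A (\<lambda>s. c * f s)) (\<lambda>t. c * A f t)) \<and>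
     (\<exists>B. \<forall>f\<in>L2 \<Omega>\<^sub>X. L2_norm \<Omega>\<^sub>Y (A f) \<le> B * L2_norm \<Omega>\<^sub>X f)"

text \<open>The analogue of \<open>onorm\<close>; functions of norm zero contribute \<open>0 / 0 = 0\<close>.\<close>

definition L2_onorm :: "'a::euclidean_space set \<Rightarrow> 'b::euclidean_space set \<Rightarrow>
    (('a \<Rightarrow> real) \<Rightarrow> ('b \<Rightarrow> real)) \<Rightarrow> real" where
  "L2_onorm \<Omega>\<^sub>X \<Omega>\<^sub>Y A = (SUP f\<in>L2 \<Omega>\<^sub>X. L2_norm \<Omega>\<^sub>Y (A f) / L2_norm \<Omega>\<^sub>X f)"

text \<open>\<open>F\<close> has Frechet derivative \<open>A\<close> at \<open>x\<close>, an interior point of the domain of \<open>F\<close>.\<close>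

definition L2_has_derivative :: "'a::euclidean_space set \<Rightarrow> 'b::euclidean_space set \<Rightarrow>
    (('a \<Rightarrow> real) \<Rightarrow> ('b \<Rightarrow> real)) \<Rightarrow> (('a \<Rightarrow> real) \<Rightarrow> ('b \<Rightarrow> real)) \<Rightarrow> ('a \<Rightarrow> real) \<Rightarrow> bool" where
  "L2_has_derivative \<Omega>\<^sub>X \<Omega>\<^sub>Y F A x \<longleftrightarrow> L2_bounded_linear \<Omega>\<^sub>X \<Omega>\<^sub>Y A \<and>
     (\<forall>e>0. \<exists>d>0. \<forall>h\<in>L2 \<Omega>\<^sub>X. L2_norm \<Omega>\<^sub>X h < d \<longrightarrow>
        L2_norm \<Omega>\<^sub>Y (\<lambda>t. F (\<lambda>s. x s + h s) t - F x t - A h t) \<le> e * L2_norm \<Omega>\<^sub>X h)"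

definition solution :: "'b::euclidean_space set \<Rightarrow> ('a \<Rightarrow> real) set \<Rightarrow>
    (('a \<Rightarrow> real) \<Rightarrow> ('b \<Rightarrow> real)) \<Rightarrow> ('b \<Rightarrow> real) \<Rightarrow> ('a \<Rightarrow> real) \<Rightarrow> bool" where
  "solution \<Omega>\<^sub>Y D F y x \<longleftrightarrow> x \<in> D \<and> L2_eq \<Omega>\<^sub>Y (F x) y"

definition minimum_norm_solution :: "'a::euclidean_space set \<Rightarrow> 'b::euclidean_space set \<Rightarrow>
    ('a \<Rightarrow> real) set \<Rightarrow> (('a \<Rightarrow> real) \<Rightarrow> ('b \<Rightarrow> real)) \<Rightarrow> ('b \<Rightarrow> real) \<Rightarrow> ('a \<Rightarrow> real) \<Rightarrow>
    ('a \<Rightarrow> real) \<Rightarrow> bool" where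
  "minimum_norm_solution \<Omega>\<^sub>X \<Omega>\<^sub>Y D F y x\<^sub>0 x \<longleftrightarrow> solution \<Omega>\<^sub>Y D F y x \<and>
     (\<forall>x'. solution \<Omega>\<^sub>Y D F y x' \<longrightarrow> L2_dist \<Omega>\<^sub>X x x\<^sub>0 \<le> L2_dist \<Omega>\<^sub>X x' x\<^sub>0)"

section \<open>Mollification\<close>

definition bump :: "'a::euclidean_space \<Rightarrow> real" where
  "bump s = (if norm s < 1 then exp (1 / ((norm s)\<^sup>2 - 1)) else 0)"

definition mollifier :: "'a::euclidean_space \<Rightarrow> real" where
  "mollifier s = bump s / (\<integral>u. bump (u::'a) \<partial>lebesgue)"

definition scaled_mollifier :: "real \<Rightarrow> 'a::euclidean_space \<Rightarrow> real" where
  "scaled_mollifier \<xi> s = mollifier (s /\<^sub>R \<xi>) / \<xi> ^ DIM('a)"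

definition convolution ::
    "('a::euclidean_space \<Rightarrow> real) \<Rightarrow> ('a \<Rightarrow> real) \<Rightarrow> 'a \<Rightarrow> real" where
  "convolution f g s = (\<integral>u. f (s - u) * g u \<partial>lebesgue)"

definition mollify ::
    "'a::euclidean_space set \<Rightarrow> real \<Rightarrow> ('a \<Rightarrow> real) \<Rightarrow> 'a \<Rightarrow> real" where
  "mollify \<Omega> \<xi> x = convolution (scaled_mollifier \<xi>) (\<lambda>u. if u \<in> \<Omega> then x u else 0)"

text \<open>
  \<open>C_closure \<Omega>\<close> is the space of continuous functions on the closure of a bounded set \<open>\<Omega>\<close>
  with the supremum metric. Its elements are undefined outside the closure, so
  \<open>mollify_C\<close> restricts the mollified function, which exists on the whole space. For open \<open>\<Omega>\<close>,
  the supremum over the closure is the \<open>L\<^sup>\<infinity>(\<Omega>)\<close> norm.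
\<close>

definition C_closure :: "'a::euclidean_space set \<Rightarrow> ('a \<Rightarrow> real) metric" where
  "C_closure \<Omega> = cfunspace (top_of_set (closure \<Omega>)) euclidean_metric"

definition mollify_C ::
    "'a::euclidean_space set \<Rightarrow> real \<Rightarrow> ('a \<Rightarrow> real) \<Rightarrow> 'a \<Rightarrow> real" where
  "mollify_C \<Omega> \<xi> x = restrict (mollify \<Omega> \<xi> x) (closure \<Omega>)"

section \<open>Neural operators\<close>

definition sigmoid :: "(real \<Rightarrow> real) \<Rightarrow> bool" where
  "sigmoid \<sigma> \<longleftrightarrow> strict_mono \<sigma> \<and> (\<forall>u. \<sigma> differentiable (at u)) \<and>
     (\<sigma> \<longlongrightarrow> 1) at_top \<and> (\<sigma> \<longlongrightarrow> 0) at_bot"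

text \<open>
  The index ranges are \<open>1..J\<close>, \<open>1..K\<close> and \<open>1..L\<close>; values at other indices are irrelevant
  and not counted in the size.
\<close>

record ('m::finite, 'n::finite) neural_coeffs =
  dim_J :: nat
  dim_K :: nat
  dim_L :: nat
  alpha :: "nat \<Rightarrow> nat \<Rightarrow> real"
  weight :: "nat \<Rightarrow> nat \<Rightarrow> nat \<Rightarrow> real"
  direction :: "nat \<Rightarrow> real ^ 'n"
  theta :: "nat \<Rightarrow> nat \<Rightarrow> real"
  node :: "nat \<Rightarrow> real ^ 'm"
  zeta :: "nat \<Rightarrow> real"

definition neural_coeffs_on :: "(real ^ 'm) set \<Rightarrow> ('m::finite, 'n::finite) neural_coeffs \<Rightarrow> bool" where
  "neural_coeffs_on \<Omega> T \<longleftrightarrow> 1 \<le> dim_J T \<and> 1 \<le> dim_K T \<and> 1 \<le> dim_L T \<and>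
     (\<forall>l\<in>{1..dim_L T}. node T l \<in> \<Omega>)"

definition neural_size :: "('m::finite, 'n::finite) neural_coeffs \<Rightarrow> nat" where
  "neural_size T = dim_J T * (dim_K T * (dim_L T + 2) + CARD('n) + 1) + dim_L T * CARD('m)"

definition neural_operator :: "(real \<Rightarrow> real) \<Rightarrow> ('m::finite, 'n::finite) neural_coeffs \<Rightarrow>
    (real ^ 'm \<Rightarrow> real) \<Rightarrow> (real ^ 'n \<Rightarrow> real)" where
  "neural_operator \<sigma> T x t =
     (\<Sum>j=1..dim_J T. \<Sum>k=1..dim_K T.
        alpha T j k * \<sigma> ((\<Sum>l=1..dim_L T. weight T j k l * x (node T l)) + theta T j k)
          * \<sigma> (direction T j \<bullet> t + zeta T j))"

end

theory Submission
  imports Defs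
begin

text \<open>
  Mollification is a contraction of \<open>L\<^sup>2\<close>, so \<open>x\<^sub>\<xi>\<close> stays in the ball of radius \<open>r\<close>, where the mean value
  inequality makes \<open>F\<close> Lipschitz with constant \<open>L\<^sub>0\<close>; it remains to approximate \<open>F\<close> up to \<open>\<epsilon>\<close> on the
  compact set of mollified functions. There \<open>F u\<close> is close to a finite sum \<open>\<Sum> \<eta>\<^sub>w(u) F w\<close> with a
  continuous partition of unity \<open>\<eta>\<^sub>w\<close>. Both the weights \<open>\<eta>\<^sub>w\<close>, as functions of point values of \<open>u\<close>, and
  the functions \<open>F w\<close> in \<open>L\<^sup>2\<close> are limits of sums of sigmoids of linear forms: exponentials of
  linear forms span a separating algebra, and the exponential on an interval is a limit of sums of
  steep sigmoids.
\<close>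

section \<open>The inner product of \<open>L\<^sup>2(\<Omega>)\<close>\<close>

text \<open>The theorem asks for one operator and one error \<epsilon> for all x in a ball that is
  not compact in L^2. The uniformity comes from the compactness of the mollified functions in the
  supremum metric; continuity of \<open>F\<close> in L^2 suffices there, since on a bounded domain
  the supremum norm dominates the L^2 norm up to a constant. The values of \<open>F\<close> depend
  nonlinearly on u and are mere L^2 functions of t, so the two variables have to be separated: the
  weights of the partition of unity carry the dependence on u, the finitely many functions
  \<open>F w\<close> carry the dependence on t, and the product of one sigmoid in u and one sigmoid
  in t is exactly a summand of a neural operator. The detour through exponentials is made because a
  product of two sigmoids is not visibly a sum of sigmoids, whereas exp a * exp b = exp (a + b)
  stays in the same family and only asks that the linear forms be closed under addition.\<close>

lemma L2_measurable: "f \<in> L2 \<Omega> \<Longrightarrow> f \<in> borel_measurable (lebesgue_on \<Omega>)"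
  by (simp add: L2_def)

lemma L2_square_integrable: "f \<in> L2 \<Omega> \<Longrightarrow> integrable (lebesgue_on \<Omega>) (\<lambda>s. (f s)\<^sup>2)"
  by (simp add: L2_def)

lemma L2_mult_integrable:
  assumes "f \<in> L2 \<Omega>" "g \<in> L2 \<Omega>"
  shows "integrable (lebesgue_on \<Omega>) (\<lambda>s. f s * g s)"
proof (rule Bochner_Integration.integrable_bound)
  show "integrable (lebesgue_on \<Omega>) (\<lambda>s. (f s)\<^sup>2 + (g s)\<^sup>2)"
    using assms by (simp add: L2_square_integrable)
  show "(\<lambda>s. f s * g s) \<in> borel_measurable (lebesgue_on \<Omega>)"
    using assms by (intro borel_measurable_times L2_measurable)
  have "\<bar>a * b\<bar> \<le> a\<^sup>2 + b\<^sup>2" for a b :: real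
    using zero_le_power2[of "\<bar>a\<bar> - \<bar>b\<bar>"] zero_le_power2[of a] zero_le_power2[of b]
    using mult_nonneg_nonneg[of "\<bar>a\<bar>" "\<bar>b\<bar>"]
    unfolding power2_diff abs_mult power2_abs by linarith
  then show "AE s in lebesgue_on \<Omega>. norm (f s * g s) \<le> norm ((f s)\<^sup>2 + (g s)\<^sup>2)"
    by (simp add: abs_of_nonneg)
qed

lemma L2_add:
  assumes "f \<in> L2 \<Omega>" "g \<in> L2 \<Omega>"
  shows "(\<lambda>s. f s + g s) \<in> L2 \<Omega>"
  using assms L2_mult_integrable[OF assms]
  by (auto simp: L2_def power2_sum mult.assoc)

lemma L2_scale: "f \<in> L2 \<Omega> \<Longrightarrow> (\<lambda>s. c * f s) \<in> L2 \<Omega>"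
  by (auto simp: L2_def power_mult_distrib)

lemma L2_diff:
  assumes "f \<in> L2 \<Omega>" "g \<in> L2 \<Omega>"
  shows "(\<lambda>s. f s - g s) \<in> L2 \<Omega>"
  using L2_add[OF assms(1) L2_scale[OF assms(2), of "-1"]] by simp

lemma L2_zero: "(\<lambda>s. 0) \<in> L2 \<Omega>"
  by (simp add: L2_def)

lemma L2_sum: "(\<And>i. i \<in> I \<Longrightarrow> f i \<in> L2 \<Omega>) \<Longrightarrow> (\<lambda>s. \<Sum>i\<in>I. f i s) \<in> L2 \<Omega>"
  by (induction I rule: infinite_finite_induct) (auto simp: L2_zero intro: L2_add)

lemma L2_norm_nonneg: "0 \<le> L2_norm \<Omega> f"
  by (simp add: L2_norm_def)

lemma L2_norm_power2: "(L2_norm \<Omega> f)\<^sup>2 = (\<integral>s. (f s)\<^sup>2 \<partial>lebesgue_on \<Omega>)"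
  by (simp add: L2_norm_def)

lemma L2_norm_scale: "L2_norm \<Omega> (\<lambda>s. c * f s) = \<bar>c\<bar> * L2_norm \<Omega> f"
  by (simp add: L2_norm_def power_mult_distrib real_sqrt_mult)

text \<open>Discriminant argument: the integral of (f + t g)^2 is a nonnegative polynomial a + 2 t b
  + t^2 c in t.\<close>

lemma L2_Cauchy_Schwarz:
  assumes f: "f \<in> L2 \<Omega>" and g: "g \<in> L2 \<Omega>"
  shows "\<bar>\<integral>s. f s * g s \<partial>lebesgue_on \<Omega>\<bar> \<le> L2_norm \<Omega> f * L2_norm \<Omega> g"
proof -
  define a where "a = (\<integral>s. (f s)\<^sup>2 \<partial>lebesgue_on \<Omega>)"
  define b where "b = (\<integral>s. f s * g s \<partial>lebesgue_on \<Omega>)"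
  define c where "c = (\<integral>s. (g s)\<^sup>2 \<partial>lebesgue_on \<Omega>)"
  have ac: "a \<ge> 0" "c \<ge> 0"
    by (simp_all add: a_def c_def)
  have q: "a + 2 * t * b + t\<^sup>2 * c \<ge> 0" for t
  proof -
    have "(\<integral>s. (f s + t * g s)\<^sup>2 \<partial>lebesgue_on \<Omega>)
        = (\<integral>s. (f s)\<^sup>2 + ((2 * t) * (f s * g s) + t\<^sup>2 * (g s)\<^sup>2) \<partial>lebesgue_on \<Omega>)"
      by (intro Bochner_Integration.integral_cong) (simp_all add: power2_eq_square algebra_simps)
    also have "\<dots> = a + (2 * t * b + t\<^sup>2 * c)"
      using L2_square_integrable[OF f] L2_square_integrable[OF g] L2_mult_integrable[OF f g]
      by (simp add: a_def b_def c_def)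
    finally have "a + (2 * t * b + t\<^sup>2 * c) = (\<integral>s. (f s + t * g s)\<^sup>2 \<partial>lebesgue_on \<Omega>)" ..
    then show ?thesis
      by (metis (no_types, lifting) add.assoc Bochner_Integration.integral_nonneg zero_le_power2)
  qed
  have "b\<^sup>2 \<le> a * c"
  proof (cases "c = 0")
    case True
    have "b = 0"
    proof (rule ccontr)
      assume "b \<noteq> 0"
      \<comment> \<open>For c = 0 the polynomial is affine in t, and this t would give it the value
        -1.\<close>
      then have "a + 2 * (- (a + 1) / (2 * b)) * b = -1"
        by (simp add: field_simps)
      then show False
        using q[of "- (a + 1) / (2 * b)"] True by simp
    qed
    then show ?thesis
      using ac by simp
  next
    case False
    \<comment> \<open>The minimizer of the quadratic polynomial is t = -b / c.\<close>
    have "a + 2 * (- b / c) * b + (- b / c)\<^sup>2 * c = a - b\<^sup>2 / c"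
      using False by (simp add: field_simps power2_eq_square)
    then have "b\<^sup>2 / c \<le> a"
      using q[of "- b / c"] by simp
    then show ?thesis
      using False ac by (simp add: field_simps)
  qed
  then have "sqrt (b\<^sup>2) \<le> sqrt (a * c)"
    by (rule real_sqrt_le_mono)
  then show ?thesis
    by (simp add: L2_norm_def a_def b_def c_def real_sqrt_mult)
qed

lemma L2_norm_triangle:
  assumes f: "f \<in> L2 \<Omega>" and g: "g \<in> L2 \<Omega>"
  shows "L2_norm \<Omega> (\<lambda>s. f s + g s) \<le> L2_norm \<Omega> f + L2_norm \<Omega> g"
proof (rule power2_le_imp_le)
  have "(L2_norm \<Omega> (\<lambda>s. f s + g s))\<^sup>2
      = (\<integral>s. (f s)\<^sup>2 + (2 * (f s * g s) + (g s)\<^sup>2) \<partial>lebesgue_on \<Omega>)"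
    unfolding L2_norm_power2
    by (intro Bochner_Integration.integral_cong) (simp_all add: power2_eq_square algebra_simps)
  also have "\<dots> = (L2_norm \<Omega> f)\<^sup>2 + (2 * (\<integral>s. f s * g s \<partial>lebesgue_on \<Omega>) + (L2_norm \<Omega> g)\<^sup>2)"
    using L2_square_integrable[OF f] L2_square_integrable[OF g] L2_mult_integrable[OF f g]
    by (simp add: L2_norm_power2)
  also have "\<dots> \<le> (L2_norm \<Omega> f + L2_norm \<Omega> g)\<^sup>2"
    using L2_Cauchy_Schwarz[OF f g] by (simp add: power2_sum)
  finally show "(L2_norm \<Omega> (\<lambda>s. f s + g s))\<^sup>2 \<le> (L2_norm \<Omega> f + L2_norm \<Omega> g)\<^sup>2" .
qed (simp add: L2_norm_nonneg)

lemma L2_norm_sum_le: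
  assumes "finite I" "\<And>i. i \<in> I \<Longrightarrow> f i \<in> L2 \<Omega>"
  shows "L2_norm \<Omega> (\<lambda>s. \<Sum>i\<in>I. f i s) \<le> (\<Sum>i\<in>I. L2_norm \<Omega> (f i))"
  using assms
proof (induction I rule: finite_induct)
  case empty
  then show ?case
    by (simp add: L2_norm_def)
next
  case (insert i I)
  have "L2_norm \<Omega> (\<lambda>s. f i s + (\<Sum>j\<in>I. f j s)) \<le> L2_norm \<Omega> (f i) + L2_norm \<Omega> (\<lambda>s. \<Sum>j\<in>I. f j s)"
    using insert.prems by (intro L2_norm_triangle L2_sum) auto
  then show ?case
    using insert by auto
qed

lemma L2_norm_cong_AE:
  assumes "L2_eq \<Omega> f g" "f \<in> borel_measurable (lebesgue_on \<Omega>)" "g \<in> borel_measurable (lebesgue_on \<Omega>)"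
  shows "L2_norm \<Omega> f = L2_norm \<Omega> g"
  unfolding L2_norm_def
  using assms by (intro arg_cong[where f = sqrt] integral_cong_AE) (auto simp: L2_eq_def)

lemma L2_dist_nonneg: "0 \<le> L2_dist \<Omega> f g"
  by (simp add: L2_dist_def L2_norm_nonneg)

lemma L2_dist_refl: "L2_dist \<Omega> f f = 0"
  by (simp add: L2_dist_def L2_norm_def)

lemma L2_dist_commute: "L2_dist \<Omega> f g = L2_dist \<Omega> g f"
  unfolding L2_dist_def L2_norm_def by (simp add: power2_commute)

lemma L2_dist_triangle:
  assumes "f \<in> L2 \<Omega>" "g \<in> L2 \<Omega>" "h \<in> L2 \<Omega>"
  shows "L2_dist \<Omega> f h \<le> L2_dist \<Omega> f g + L2_dist \<Omega> g h"
  using L2_norm_triangle[OF L2_diff[OF assms(1,2)] L2_diff[OF assms(2,3)]]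
  by (simp add: L2_dist_def)

lemma L2_dist_cong_AE:
  assumes "L2_eq \<Omega> f f'" "L2_eq \<Omega> g g'" "f \<in> L2 \<Omega>" "f' \<in> L2 \<Omega>" "g \<in> L2 \<Omega>" "g' \<in> L2 \<Omega>"
  shows "L2_dist \<Omega> f g = L2_dist \<Omega> f' g'"
  unfolding L2_dist_def
proof (rule L2_norm_cong_AE)
  show "L2_eq \<Omega> (\<lambda>s. f s - g s) (\<lambda>s. f' s - g' s)"
    using assms(1,2) unfolding L2_eq_def by eventually_elim simp
qed (use assms in \<open>simp_all add: L2_measurable L2_diff\<close>)

lemma L2_norm_mono_AE:
  assumes "AE s in lebesgue_on \<Omega>. \<bar>f s\<bar> \<le> \<bar>g s\<bar>" "f \<in> L2 \<Omega>" "g \<in> L2 \<Omega>"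
  shows "L2_norm \<Omega> f \<le> L2_norm \<Omega> g"
  unfolding L2_norm_def
  using assms by (intro real_sqrt_le_mono integral_mono_AE) (auto simp: L2_square_integrable abs_le_square_iff)

lemma bounded_in_L2:
  assumes "\<Omega> \<in> lmeasurable" "f \<in> borel_measurable (lebesgue_on \<Omega>)" "\<And>s. s \<in> \<Omega> \<Longrightarrow> \<bar>f s\<bar> \<le> B"
  shows "f \<in> L2 \<Omega>"
proof -
  interpret finite_measure "lebesgue_on \<Omega>"
    using assms(1) by (rule finite_measure_lebesgue_on)
  have "(f s)\<^sup>2 \<le> B\<^sup>2" if "s \<in> \<Omega>" for s
    using assms(3)[OF that] by (metis abs_ge_zero abs_le_square_iff abs_of_nonneg order_trans)
  then show ?thesis
    using assms(2) unfolding L2_def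
    by (auto intro!: integrable_const_bound[of _ "B\<^sup>2"] simp: AE_restrict_space_iff)
qed

lemma L2_norm_le_bound:
  assumes "\<Omega> \<in> lmeasurable" "f \<in> borel_measurable (lebesgue_on \<Omega>)"
    and B: "\<And>s. s \<in> \<Omega> \<Longrightarrow> \<bar>f s\<bar> \<le> B" "0 \<le> B"
  shows "L2_norm \<Omega> f \<le> B * sqrt (measure lebesgue \<Omega>)"
proof -
  interpret finite_measure "lebesgue_on \<Omega>"
    using assms(1) by (rule finite_measure_lebesgue_on)
  have "(\<lambda>s. B) \<in> L2 \<Omega>"
    by (rule bounded_in_L2[of _ _ "\<bar>B\<bar>"]) (use assms in auto)
  then have "L2_norm \<Omega> f \<le> L2_norm \<Omega> (\<lambda>s. B)"
    using assms(1,2) B by (intro L2_norm_mono_AE bounded_in_L2[of _ f B])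
      (auto intro!: AE_I2)
  also have "\<dots> = sqrt (B\<^sup>2 * measure lebesgue \<Omega>)"
    using assms(1) by (simp add: L2_norm_def measure_restrict_space fmeasurableD mult.commute)
  finally show ?thesis
    using B(2) by (simp add: real_sqrt_mult)
qed

section \<open>Lipschitz estimate from the derivative\<close>

text \<open>The bound B makes the supremum in \<open>L2_onorm\<close> bounded above, so that it
  dominates each quotient. If h has norm zero, the quotient is 0 by the convention for division and
  says nothing; then B itself forces the norm of \<open>A h\<close> to vanish. Only the bound is
  assumed of A, so that the lemma also applies to a difference of operators.\<close>

lemma L2_onorm_bound:
  assumes B: "\<forall>f\<in>L2 \<Omega>\<^sub>X. L2_norm \<Omega>\<^sub>Y (A f) \<le> B * L2_norm \<Omega>\<^sub>X f" and h: "h \<in> L2 \<Omega>\<^sub>X"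
  shows "L2_norm \<Omega>\<^sub>Y (A h) \<le> L2_onorm \<Omega>\<^sub>X \<Omega>\<^sub>Y A * L2_norm \<Omega>\<^sub>X h"
    and "0 \<le> L2_onorm \<Omega>\<^sub>X \<Omega>\<^sub>Y A"
proof -
  have le: "L2_norm \<Omega>\<^sub>Y (A f) / L2_norm \<Omega>\<^sub>X f \<le> \<bar>B\<bar>" if "f \<in> L2 \<Omega>\<^sub>X" for f
  proof (cases "L2_norm \<Omega>\<^sub>X f = 0")
    case False
    then have "L2_norm \<Omega>\<^sub>X f > 0"
      using L2_norm_nonneg[of \<Omega>\<^sub>X f] by simp
    moreover have "L2_norm \<Omega>\<^sub>Y (A f) \<le> \<bar>B\<bar> * L2_norm \<Omega>\<^sub>X f"
      using B that L2_norm_nonneg[of \<Omega>\<^sub>X f] by (meson abs_ge_self mult_right_mono order_trans)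
    ultimately show ?thesis
      by (simp add: pos_divide_le_eq)
  qed auto
  then have up: "L2_norm \<Omega>\<^sub>Y (A f) / L2_norm \<Omega>\<^sub>X f \<le> L2_onorm \<Omega>\<^sub>X \<Omega>\<^sub>Y A" if "f \<in> L2 \<Omega>\<^sub>X" for f
    unfolding L2_onorm_def using that by (intro cSUP_upper bdd_aboveI2)
  show "0 \<le> L2_onorm \<Omega>\<^sub>X \<Omega>\<^sub>Y A"
    using up[OF h] by (rule order_trans[rotated]) (simp add: L2_norm_nonneg)
  show "L2_norm \<Omega>\<^sub>Y (A h) \<le> L2_onorm \<Omega>\<^sub>X \<Omega>\<^sub>Y A * L2_norm \<Omega>\<^sub>X h"
  proof (cases "L2_norm \<Omega>\<^sub>X h = 0")
    case True
    then show ?thesis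
      using B h by force
  next
    case False
    then have "L2_norm \<Omega>\<^sub>X h > 0"
      using L2_norm_nonneg[of \<Omega>\<^sub>X h] by simp
    then show ?thesis
      using up[OF h] by (simp add: pos_divide_le_eq)
  qed
qed

lemma L2_bounded_linear_in_L2: "L2_bounded_linear \<Omega>\<^sub>X \<Omega>\<^sub>Y A \<Longrightarrow> h \<in> L2 \<Omega>\<^sub>X \<Longrightarrow> A h \<in> L2 \<Omega>\<^sub>Y"
  by (auto simp: L2_bounded_linear_def L2_operator_def)

text \<open>Triangle inequality for A = A' + (A - A'). The bounds B and B' give the bound B + B' for
  the difference, without which its \<open>L2_onorm\<close> would be a supremum of a possibly
  unbounded set.\<close>

lemma L2_norm_le_onorm_diff:
  assumes A: "L2_bounded_linear \<Omega>\<^sub>X \<Omega>\<^sub>Y A" and A': "L2_bounded_linear \<Omega>\<^sub>X \<Omega>\<^sub>Y A'" and h: "h \<in> L2 \<Omega>\<^sub>X"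
  shows "L2_norm \<Omega>\<^sub>Y (A h)
    \<le> (L2_onorm \<Omega>\<^sub>X \<Omega>\<^sub>Y A' + L2_onorm \<Omega>\<^sub>X \<Omega>\<^sub>Y (\<lambda>h t. A h t - A' h t)) * L2_norm \<Omega>\<^sub>X h"
proof -
  obtain B B' where B: "\<forall>f\<in>L2 \<Omega>\<^sub>X. L2_norm \<Omega>\<^sub>Y (A f) \<le> B * L2_norm \<Omega>\<^sub>X f"
    and B': "\<forall>f\<in>L2 \<Omega>\<^sub>X. L2_norm \<Omega>\<^sub>Y (A' f) \<le> B' * L2_norm \<Omega>\<^sub>X f"
    using A A' unfolding L2_bounded_linear_def by blast
  have diff: "L2_norm \<Omega>\<^sub>Y (\<lambda>t. A f t - A' f t) \<le> (B + B') * L2_norm \<Omega>\<^sub>X f" if f: "f \<in> L2 \<Omega>\<^sub>X" for f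
  proof -
    have "L2_norm \<Omega>\<^sub>Y (\<lambda>t. A f t + (-1) * A' f t) \<le> L2_norm \<Omega>\<^sub>Y (A f) + L2_norm \<Omega>\<^sub>Y (\<lambda>t. (-1) * A' f t)"
      by (intro L2_norm_triangle L2_scale L2_bounded_linear_in_L2[OF A f] L2_bounded_linear_in_L2[OF A' f])
    also have "\<dots> = L2_norm \<Omega>\<^sub>Y (A f) + L2_norm \<Omega>\<^sub>Y (A' f)"
      by (simp only: L2_norm_scale)
    finally show ?thesis
      using B B' f by (force simp: distrib_right)
  qed
  have "L2_norm \<Omega>\<^sub>Y (\<lambda>t. A' h t + (A h t - A' h t)) \<le> L2_norm \<Omega>\<^sub>Y (A' h) + L2_norm \<Omega>\<^sub>Y (\<lambda>t. A h t - A' h t)"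
    by (intro L2_norm_triangle L2_diff L2_bounded_linear_in_L2[OF A h] L2_bounded_linear_in_L2[OF A' h])
  also have "\<dots> \<le> L2_onorm \<Omega>\<^sub>X \<Omega>\<^sub>Y A' * L2_norm \<Omega>\<^sub>X h
      + L2_onorm \<Omega>\<^sub>X \<Omega>\<^sub>Y (\<lambda>h t. A h t - A' h t) * L2_norm \<Omega>\<^sub>X h"
    using L2_onorm_bound(1)[OF B' h] L2_onorm_bound(1)[of \<Omega>\<^sub>X \<Omega>\<^sub>Y "\<lambda>h t. A h t - A' h t", OF _ h] diff
    by (intro add_mono) auto
  finally show ?thesis
    by (simp add: distrib_right)
qed

text \<open>Keeps the segment of the mean value argument inside the ball where the derivative
  exists.\<close>

lemma L2_ball_convex:
  assumes x: "x \<in> L2_ball \<Omega> c r" and x': "x' \<in> L2_ball \<Omega> c r" and c: "c \<in> L2 \<Omega>"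
    and t: "0 \<le> t" "t \<le> 1"
  shows "(\<lambda>s. x' s + t * (x s - x' s)) \<in> L2_ball \<Omega> c r"
proof -
  have xs: "x \<in> L2 \<Omega>" "x' \<in> L2 \<Omega>" "L2_dist \<Omega> x c < r" "L2_dist \<Omega> x' c < r"
    using x x' by (auto simp: L2_ball_def)
  have "L2_dist \<Omega> (\<lambda>s. x' s + t * (x s - x' s)) c
      = L2_norm \<Omega> (\<lambda>s. (1 - t) * (x' s - c s) + t * (x s - c s))"
    by (simp add: L2_dist_def algebra_simps)
  also have "\<dots> \<le> L2_norm \<Omega> (\<lambda>s. (1 - t) * (x' s - c s)) + L2_norm \<Omega> (\<lambda>s. t * (x s - c s))"
    using xs c by (intro L2_norm_triangle L2_scale L2_diff)
  also have "\<dots> = (1 - t) * L2_dist \<Omega> x' c + t * L2_dist \<Omega> x c"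
    using t by (simp add: L2_norm_scale L2_dist_def)
  also have "\<dots> < r"
    using xs t by (intro convex_bound_lt) auto
  finally show ?thesis
    using xs by (auto simp: L2_ball_def intro!: L2_add L2_scale L2_diff)
qed

text \<open>The mean value theorem is applied to the scalar function
  \<open>t \<mapsto> \<langle>F (x' + t (x - x')), F x - F x'\<rangle>\<close>.\<close>

lemma L2_mean_value_bound:
  assumes F: "\<And>z. z \<in> L2_ball \<Omega>\<^sub>X c r \<Longrightarrow> F z \<in> L2 \<Omega>\<^sub>Y"
    and deriv: "\<And>z. z \<in> L2_ball \<Omega>\<^sub>X c r \<Longrightarrow> L2_has_derivative \<Omega>\<^sub>X \<Omega>\<^sub>Y F (F' z) z"
    and bound: "\<And>z h. z \<in> L2_ball \<Omega>\<^sub>X c r \<Longrightarrow> h \<in> L2 \<Omega>\<^sub>X \<Longrightarrow> L2_norm \<Omega>\<^sub>Y (F' z h) \<le> L * L2_norm \<Omega>\<^sub>X h"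
    and x: "x \<in> L2_ball \<Omega>\<^sub>X c r" and x': "x' \<in> L2_ball \<Omega>\<^sub>X c r" and c: "c \<in> L2 \<Omega>\<^sub>X"
  shows "L2_dist \<Omega>\<^sub>Y (F x) (F x') \<le> L * L2_dist \<Omega>\<^sub>X x x'"
proof -
  define h where "h = (\<lambda>s. x s - x' s)"
  define \<gamma> where "\<gamma> = (\<lambda>t s. x' s + t * h s)"
  define w where "w = (\<lambda>t. F x t - F x' t)"
  define p where "p = (\<lambda>t. \<integral>s. F (\<gamma> t) s * w s \<partial>lebesgue_on \<Omega>\<^sub>Y)"
  define q where "q = (\<lambda>t. \<integral>s. F' (\<gamma> t) h s * w s \<partial>lebesgue_on \<Omega>\<^sub>Y)"
  have h: "h \<in> L2 \<Omega>\<^sub>X"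
    unfolding h_def using x x' by (intro L2_diff) (auto simp: L2_ball_def)
  have w: "w \<in> L2 \<Omega>\<^sub>Y"
    unfolding w_def using F x x' by (intro L2_diff) auto
  have ball: "\<gamma> t \<in> L2_ball \<Omega>\<^sub>X c r" if "t \<in> {0..1}" for t
    unfolding \<gamma>_def h_def using L2_ball_convex[OF x x' c] that by auto
  have lin: "L2_bounded_linear \<Omega>\<^sub>X \<Omega>\<^sub>Y (F' (\<gamma> t))" if "t \<in> {0..1}" for t
    using deriv[OF ball[OF that]] by (simp add: L2_has_derivative_def)
  \<comment> \<open>The scalar remainder is the Frechet remainder paired with w, so Cauchy-Schwarz
    bounds it. Homogeneity of the derivative holds only almost everywhere, hence the comparison of
    integrals by \<open>integral_cong_AE\<close>.\<close>
  have rem: "\<bar>p (t + k) - p t - k * q t\<bar>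
      \<le> L2_norm \<Omega>\<^sub>Y (\<lambda>s. F (\<gamma> (t + k)) s - F (\<gamma> t) s - F' (\<gamma> t) (\<lambda>s. k * h s) s) * L2_norm \<Omega>\<^sub>Y w"
    if t: "t \<in> {0..1}" and tk: "t + k \<in> {0..1}" for t k
  proof -
    have A: "F' (\<gamma> t) h \<in> L2 \<Omega>\<^sub>Y" "F' (\<gamma> t) (\<lambda>s. k * h s) \<in> L2 \<Omega>\<^sub>Y"
      using L2_bounded_linear_in_L2[OF lin[OF t] h] L2_bounded_linear_in_L2[OF lin[OF t] L2_scale[OF h]] .
    have FF: "F (\<gamma> (t + k)) \<in> L2 \<Omega>\<^sub>Y" "F (\<gamma> t) \<in> L2 \<Omega>\<^sub>Y"
      using F[OF ball[OF tk]] F[OF ball[OF t]] .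
    have eq: "AE s in lebesgue_on \<Omega>\<^sub>Y. F' (\<gamma> t) (\<lambda>s. k * h s) s = k * F' (\<gamma> t) h s"
      using lin[OF t] h by (auto simp: L2_bounded_linear_def L2_eq_def)
    have "p (t + k) - p t - k * q t
        = (\<integral>s. F (\<gamma> (t + k)) s * w s - F (\<gamma> t) s * w s - k * (F' (\<gamma> t) h s * w s) \<partial>lebesgue_on \<Omega>\<^sub>Y)"
      unfolding p_def q_def using L2_mult_integrable[OF _ w] A FF by simp
    also have "\<dots> = (\<integral>s. (F (\<gamma> (t + k)) s - F (\<gamma> t) s - F' (\<gamma> t) (\<lambda>s. k * h s) s) * w s \<partial>lebesgue_on \<Omega>\<^sub>Y)"
    proof (rule integral_cong_AE)
      show "AE s in lebesgue_on \<Omega>\<^sub>Y. F (\<gamma> (t + k)) s * w s - F (\<gamma> t) s * w s - k * (F' (\<gamma> t) h s * w s)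
          = (F (\<gamma> (t + k)) s - F (\<gamma> t) s - F' (\<gamma> t) (\<lambda>s. k * h s) s) * w s"
        using eq by eventually_elim (simp add: algebra_simps)
    qed (intro borel_measurable_diff borel_measurable_times borel_measurable_const
        L2_measurable[OF A(1)] L2_measurable[OF A(2)] L2_measurable[OF FF(1)] L2_measurable[OF FF(2)]
        L2_measurable[OF w])+
    finally show ?thesis
      using L2_Cauchy_Schwarz[OF L2_diff[OF L2_diff[OF FF] A(2)] w] by simp
  qed
  have DERIV: "(p has_derivative (\<lambda>k. k * q t)) (at t within {0..1})" if t: "t \<in> {0..1}" for t
    unfolding has_derivative_within_alt
  proof (intro conjI allI impI)
    show "bounded_linear (\<lambda>k. k * q t)"
      by (rule bounded_linear_mult_left)
    fix e :: real
    assume "e > 0"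
    \<comment> \<open>The summand 1 keeps the divisor positive if h or w has norm zero; the surplus
      shows up below as the factor (N - 1) / N.\<close>
    define N where "N = L2_norm \<Omega>\<^sub>X h * L2_norm \<Omega>\<^sub>Y w + 1"
    have N: "N > 0"
      by (auto simp: N_def L2_norm_nonneg add_nonneg_pos)
    have "0 < e / N"
      using \<open>e > 0\<close> N by simp
    from deriv[OF ball[OF t], unfolded L2_has_derivative_def, THEN conjunct2, THEN spec, THEN mp, OF this]
    obtain d where d: "d > 0" and small: "\<forall>g\<in>L2 \<Omega>\<^sub>X. L2_norm \<Omega>\<^sub>X g < d \<longrightarrow>
        L2_norm \<Omega>\<^sub>Y (\<lambda>s. F (\<lambda>s. \<gamma> t s + g s) s - F (\<gamma> t) s - F' (\<gamma> t) g s) \<le> e / N * L2_norm \<Omega>\<^sub>X g"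
      by (elim exE conjE) (rule that)
    show "\<exists>d>0. \<forall>u\<in>{0..1}. norm (u - t) < d \<longrightarrow> norm (p u - p t - (u - t) * q t) \<le> e * norm (u - t)"
    proof (intro exI conjI ballI impI)
      show "0 < d / (L2_norm \<Omega>\<^sub>X h + 1)"
        using d L2_norm_nonneg[of \<Omega>\<^sub>X h] by simp
      fix u :: real
      assume u: "u \<in> {0..1}" "norm (u - t) < d / (L2_norm \<Omega>\<^sub>X h + 1)"
      define k where "k = u - t"
      have "L2_norm \<Omega>\<^sub>X (\<lambda>s. k * h s) = \<bar>k\<bar> * L2_norm \<Omega>\<^sub>X h"
        by (rule L2_norm_scale)
      moreover have "\<bar>k\<bar> * (L2_norm \<Omega>\<^sub>X h + 1) < d"
        using u(2) L2_norm_nonneg[of \<Omega>\<^sub>X h] by (simp add: k_def pos_less_divide_eq add_nonneg_pos)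
      ultimately have lt: "L2_norm \<Omega>\<^sub>X (\<lambda>s. k * h s) < d"
        by (simp add: distrib_left)
      have \<gamma>: "(\<lambda>s. \<gamma> t s + k * h s) = \<gamma> (t + k)"
        by (simp add: \<gamma>_def algebra_simps)
      have "\<bar>p u - p t - k * q t\<bar> \<le> (e / N * L2_norm \<Omega>\<^sub>X (\<lambda>s. k * h s)) * L2_norm \<Omega>\<^sub>Y w"
      proof (rule order_trans)
        show "\<bar>p u - p t - k * q t\<bar>
            \<le> L2_norm \<Omega>\<^sub>Y (\<lambda>s. F (\<gamma> (t + k)) s - F (\<gamma> t) s - F' (\<gamma> t) (\<lambda>s. k * h s) s) * L2_norm \<Omega>\<^sub>Y w"
          using rem[OF t, of k] u(1) by (simp add: k_def)
        show "\<dots> \<le> (e / N * L2_norm \<Omega>\<^sub>X (\<lambda>s. k * h s)) * L2_norm \<Omega>\<^sub>Y w"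
          by (rule mult_right_mono[OF small[rule_format, OF L2_scale[OF h] lt, unfolded \<gamma>] L2_norm_nonneg])
      qed
      also have "\<dots> = e * \<bar>k\<bar> * ((N - 1) / N)"
        by (simp add: L2_norm_scale N_def)
      also have "\<dots> \<le> e * \<bar>k\<bar> * 1"
        using N \<open>e > 0\<close> by (intro mult_left_mono) auto
      finally show "norm (p u - p t - (u - t) * q t) \<le> e * norm (u - t)"
        by (simp add: k_def)
    qed
  qed
  \<comment> \<open>Pairing with w = F x - F x' makes the increment of p equal to the squared norm
    of w, from which one factor is cancelled at the end.\<close>
  obtain t where t: "t \<in> {0<..<1}" "p 1 - p 0 = 1 * q t"
    using mvt_simple[of 0 1 p "\<lambda>t k. k * q t"] DERIV by auto
  have "\<gamma> 1 = x" "\<gamma> 0 = x'"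
    by (simp_all add: \<gamma>_def h_def)
  then have "p 1 - p 0 = (\<integral>s. F x s * w s - F x' s * w s \<partial>lebesgue_on \<Omega>\<^sub>Y)"
    unfolding p_def using L2_mult_integrable[OF _ w] F x x' by simp
  also have "\<dots> = (L2_norm \<Omega>\<^sub>Y w)\<^sup>2"
    unfolding L2_norm_power2
    by (intro Bochner_Integration.integral_cong) (simp_all add: w_def power2_eq_square algebra_simps)
  finally have "(L2_norm \<Omega>\<^sub>Y w)\<^sup>2 = q t"
    using t by simp
  also have "\<dots> \<le> L2_norm \<Omega>\<^sub>Y (F' (\<gamma> t) h) * L2_norm \<Omega>\<^sub>Y w"
    unfolding q_def using t L2_Cauchy_Schwarz[OF L2_bounded_linear_in_L2[OF lin h] w, of t] by auto
  also have "\<dots> \<le> (L * L2_norm \<Omega>\<^sub>X h) * L2_norm \<Omega>\<^sub>Y w"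
    using bound[OF ball h, of t] t by (intro mult_right_mono) (auto simp: L2_norm_nonneg)
  finally have sq: "L2_norm \<Omega>\<^sub>Y w * L2_norm \<Omega>\<^sub>Y w \<le> (L * L2_norm \<Omega>\<^sub>X h) * L2_norm \<Omega>\<^sub>Y w"
    by (simp add: power2_eq_square)
  have "0 \<le> L * L2_norm \<Omega>\<^sub>X h"
    using bound[OF x h] L2_norm_nonneg[of \<Omega>\<^sub>Y "F' x h"] by simp
  then have "L2_norm \<Omega>\<^sub>Y w \<le> L * L2_norm \<Omega>\<^sub>X h"
    using sq L2_norm_nonneg[of \<Omega>\<^sub>Y w] by (cases "L2_norm \<Omega>\<^sub>Y w = 0") auto
  then show ?thesis
    by (simp add: L2_dist_def w_def h_def)
qed

section \<open>Mollification is a contraction of \<open>L\<^sup>2(\<Omega>)\<close>\<close>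

lemma nn_integral_lborel_affine:
  fixes t :: "'a::euclidean_space"
  assumes [measurable]: "f \<in> borel_measurable borel" and "c \<noteq> 0"
  shows "(\<integral>\<^sup>+u. f u \<partial>lborel) = ennreal (\<bar>c\<bar> ^ DIM('a)) * (\<integral>\<^sup>+u. f (t + c *\<^sub>R u) \<partial>lborel)"
  by (subst lborel_affine[OF assms(2), of t])
    (simp add: nn_integral_density nn_integral_distr nn_integral_cmult)

lemma bump_nonneg: "0 \<le> bump s"
  by (simp add: bump_def)

lemma bump_le_1: "bump s \<le> 1"
proof (cases "norm s < 1")
  case True
  then have "(norm s)\<^sup>2 < 1"
    by (simp add: power_less_one_iff abs_square_less_1)
  then show ?thesis
    by (simp add: bump_def divide_nonpos_neg)
qed (simp add: bump_def)

lemma bump_measurable [measurable]: "bump \<in> borel_measurable borel"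
  unfolding bump_def[abs_def] by measurable

lemma integrable_bump: "integrable lborel (bump :: 'a::euclidean_space \<Rightarrow> real)"
proof (rule Bochner_Integration.integrable_bound)
  show "integrable lborel (indicator (ball (0::'a) 1) :: 'a \<Rightarrow> real)"
    by (intro integrable_real_indicator emeasure_bounded_finite) auto
  show "AE s in lborel. norm (bump s) \<le> norm (indicator (ball (0::'a) 1) s :: real)"
    by (rule AE_I2) (use bump_le_1 in \<open>auto simp: bump_nonneg indicator_def, simp add: bump_def\<close>)
qed simp

lemma integral_bump_pos: "0 < (\<integral>u. bump (u::'a::euclidean_space) \<partial>lborel)"
proof -
  \<comment> \<open>On this ball the squared norm is at most 1/2, so the exponent 1 / (|u|^2 - 1) is
    at least -2.\<close>
  have le: "exp (-2) * indicator (ball 0 (1/2)) u \<le> bump (u::'a)" for u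
  proof (cases "u \<in> ball 0 (1/2)")
    case True
    then have n: "norm u < 1/2"
      by simp
    then have "(norm u)\<^sup>2 \<le> (1/2)\<^sup>2"
      by (intro power_mono) auto
    then have "(norm u)\<^sup>2 \<le> 1/2"
      by (simp add: power2_eq_square)
    then have "-2 \<le> 1 / ((norm u)\<^sup>2 - 1)"
      by (subst neg_le_divide_eq) auto
    then show ?thesis
      using True n by (simp add: bump_def)
  qed (simp add: bump_nonneg)
  have "0 < exp (-2) * measure lborel (ball (0::'a) (1/2))"
    by (simp add: content_ball_pos)
  also have "\<dots> = (\<integral>u. exp (-2) * indicator (ball 0 (1/2)) (u::'a) \<partial>lborel)"
    by simp
  also have "\<dots> \<le> (\<integral>u. bump (u::'a) \<partial>lborel)"
    using le by (intro integral_mono integrable_bump) (auto intro!: integrable_real_indicator emeasure_bounded_finite)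
  finally show ?thesis .
qed

text \<open>The mollifier is normalized by Lebesgue measure, while substitution and Tonelli are
  carried out with \<open>lborel\<close>.\<close>

lemma integral_lebesgue_bump: "(\<integral>u. bump (u::'a::euclidean_space) \<partial>lebesgue) = (\<integral>u. bump (u::'a) \<partial>lborel)"
  by (rule integral_completion) simp

lemma mollifier_nonneg: "0 \<le> mollifier (s :: 'a::euclidean_space)"
  using integral_bump_pos[where 'a = 'a] by (simp add: mollifier_def bump_nonneg integral_lebesgue_bump)

lemma mollifier_measurable [measurable]: "(mollifier :: 'a::euclidean_space \<Rightarrow> real) \<in> borel_measurable borel"
  unfolding mollifier_def[abs_def] by measurable

lemma nn_integral_mollifier: "(\<integral>\<^sup>+u. ennreal (mollifier (u::'a::euclidean_space)) \<partial>lborel) = 1"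
proof -
  have "(\<integral>\<^sup>+u. ennreal (mollifier (u::'a)) \<partial>lborel) = ennreal (\<integral>u. mollifier (u::'a) \<partial>lborel)"
    unfolding mollifier_def
    using integrable_bump[where 'a = 'a] integral_bump_pos[where 'a = 'a]
    by (intro nn_integral_eq_integral) (auto simp: integral_lebesgue_bump bump_nonneg)
  also have "(\<integral>u. mollifier (u::'a) \<partial>lborel) = 1"
    using integral_bump_pos[where 'a = 'a] by (simp add: mollifier_def integral_lebesgue_bump)
  finally show ?thesis
    by simp
qed

lemma scaled_mollifier_nonneg: "0 < \<xi> \<Longrightarrow> 0 \<le> scaled_mollifier \<xi> s"
  by (simp add: scaled_mollifier_def mollifier_nonneg)

lemma scaled_mollifier_bounded:
  assumes "0 < \<xi>"
  shows "\<bar>scaled_mollifier \<xi> (s::'a::euclidean_space)\<bar> \<le> 1 / (\<integral>u. bump (u::'a) \<partial>lborel) / \<xi> ^ DIM('a)"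
  using assms integral_bump_pos[where 'a = 'a]
  by (auto simp: scaled_mollifier_def mollifier_def integral_lebesgue_bump abs_mult bump_nonneg bump_le_1
      intro!: divide_right_mono)

lemma scaled_mollifier_measurable [measurable]:
  "(scaled_mollifier \<xi> :: 'a::euclidean_space \<Rightarrow> real) \<in> borel_measurable borel"
  unfolding scaled_mollifier_def[abs_def] by measurable

text \<open>Substitution with factor -\<xi> and \<xi>, respectively. The first form makes the kernel
  a probability density in u for fixed s, as the weighted Cauchy-Schwarz inequality requires; the
  second integrates out the outer variable after Tonelli.\<close>

lemma nn_integral_scaled_mollifier:
  fixes s :: "'a::euclidean_space"
  assumes "0 < \<xi>"
  shows "(\<integral>\<^sup>+u. ennreal (scaled_mollifier \<xi> (s - u)) \<partial>lborel) = 1"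
    and "(\<integral>\<^sup>+u. ennreal (scaled_mollifier \<xi> (u - s)) \<partial>lborel) = 1"
proof -
  have *: "ennreal (\<xi> ^ DIM('a)) * (\<integral>\<^sup>+u. ennreal (scaled_mollifier \<xi> (\<xi> *\<^sub>R (u::'a))) \<partial>lborel) = 1"
  proof -
    have "ennreal (\<xi> ^ DIM('a)) * (\<integral>\<^sup>+u. ennreal (scaled_mollifier \<xi> (\<xi> *\<^sub>R (u::'a))) \<partial>lborel)
        = (\<integral>\<^sup>+u. ennreal (\<xi> ^ DIM('a)) * ennreal (scaled_mollifier \<xi> (\<xi> *\<^sub>R (u::'a))) \<partial>lborel)"
      by (rule nn_integral_cmult[symmetric]) measurable
    also have "\<dots> = (\<integral>\<^sup>+u. ennreal (mollifier (u::'a)) \<partial>lborel)"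
      using assms
      by (intro nn_integral_cong) (simp add: scaled_mollifier_def mollifier_nonneg flip: ennreal_mult)
    finally show ?thesis
      by (simp add: nn_integral_mollifier)
  qed
  show "(\<integral>\<^sup>+u. ennreal (scaled_mollifier \<xi> (s - u)) \<partial>lborel) = 1"
    using assms * by (subst nn_integral_lborel_affine[where c = "-\<xi>" and t = s]) auto
  show "(\<integral>\<^sup>+u. ennreal (scaled_mollifier \<xi> (u - s)) \<partial>lborel) = 1"
    using assms * by (subst nn_integral_lborel_affine[where c = \<xi> and t = s]) auto
qed

text \<open>Weighted Cauchy-Schwarz, with the two factors \<open>sqrt (\<phi> (s - u))\<close> and \<open>sqrt (\<phi> (s - u)) * \<bar>g u\<bar>\<close>.\<close>

lemma convolution_scaled_mollifier_power2_le:
  fixes g :: "'a::euclidean_space \<Rightarrow> real"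
  assumes \<xi>: "0 < \<xi>" and [measurable]: "g \<in> borel_measurable borel"
  shows "ennreal ((\<integral>u. scaled_mollifier \<xi> (s - u) * g u \<partial>lborel)\<^sup>2)
    \<le> (\<integral>\<^sup>+u. ennreal (scaled_mollifier \<xi> (s - u)) * ennreal ((g u)\<^sup>2) \<partial>lborel)"
proof -
  let ?\<phi> = "\<lambda>u. scaled_mollifier \<xi> (s - u)"
  have nonneg: "0 \<le> ?\<phi> u" for u
    using \<xi> by (rule scaled_mollifier_nonneg)
  \<comment> \<open>If the product is not integrable, its integral is 0 by convention and the bound
    is trivial.\<close>
  have "ennreal \<bar>\<integral>u. ?\<phi> u * g u \<partial>lborel\<bar> \<le> (\<integral>\<^sup>+u. ennreal (norm (?\<phi> u * g u)) \<partial>lborel)"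
  proof (cases "integrable lborel (\<lambda>u. ?\<phi> u * g u)")
    case True
    then show ?thesis
      using integral_norm_bound_ennreal by fastforce
  qed (simp add: not_integrable_integral_eq)
  also have "\<dots> = (\<integral>\<^sup>+u. ennreal (sqrt (?\<phi> u)) * ennreal (sqrt (?\<phi> u) * \<bar>g u\<bar>) \<partial>lborel)"
    using nonneg by (intro nn_integral_cong) (simp add: abs_mult flip: ennreal_mult mult.assoc)
  finally have "(ennreal \<bar>\<integral>u. ?\<phi> u * g u \<partial>lborel\<bar>)\<^sup>2
      \<le> (\<integral>\<^sup>+u. ennreal (sqrt (?\<phi> u)) * ennreal (sqrt (?\<phi> u) * \<bar>g u\<bar>) \<partial>lborel)\<^sup>2"
    by (rule power_mono) simp
  also have "\<dots> \<le> (\<integral>\<^sup>+u. (ennreal (sqrt (?\<phi> u)))\<^sup>2 \<partial>lborel) * (\<integral>\<^sup>+u. (ennreal (sqrt (?\<phi> u) * \<bar>g u\<bar>))\<^sup>2 \<partial>lborel)"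
    by (rule Cauchy_Schwarz_nn_integral) measurable
  also have "(\<integral>\<^sup>+u. (ennreal (sqrt (?\<phi> u)))\<^sup>2 \<partial>lborel) = 1"
    using nonneg nn_integral_scaled_mollifier(1)[OF \<xi>, of s] by (simp add: ennreal_power)
  also have "(\<integral>\<^sup>+u. (ennreal (sqrt (?\<phi> u) * \<bar>g u\<bar>))\<^sup>2 \<partial>lborel) = (\<integral>\<^sup>+u. ennreal (?\<phi> u) * ennreal ((g u)\<^sup>2) \<partial>lborel)"
    using nonneg by (intro nn_integral_cong) (simp add: ennreal_power power_mult_distrib flip: ennreal_mult)
  finally show ?thesis
    by (simp add: ennreal_power)
qed

text \<open>Young's inequality for a kernel of mass 1: bound the square of the convolution
  pointwise, exchange the integrals, and integrate the kernel to 1. Integrating the convolution over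
  \<open>\<Omega>\<close> only loses mass, and the extension by zero adds none on the right.\<close>

lemma L2_norm_mollify_le:
  fixes \<Omega> :: "'a::euclidean_space set"
  assumes \<xi>: "0 < \<xi>" and h: "h \<in> L2 \<Omega>" and \<Omega>: "\<Omega> \<in> sets lebesgue"
  shows "L2_norm \<Omega> (mollify \<Omega> \<xi> h) \<le> L2_norm \<Omega> h"
proof -
  let ?\<phi> = "scaled_mollifier \<xi> :: 'a \<Rightarrow> real"
  define h0 where "h0 = (\<lambda>u. if u \<in> \<Omega> then h u else 0)"
  have h0: "h0 \<in> borel_measurable lebesgue"
    unfolding h0_def using L2_measurable[OF h] \<Omega> by (simp add: borel_measurable_if)
  \<comment> \<open>A Borel version of the extension gives a jointly measurable integrand for
    Tonelli; changing it on a null set leaves every convolution value unchanged.\<close>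
  obtain g where [measurable]: "g \<in> borel_measurable borel" and g: "AE u in lborel. h0 u = g u"
    using completion_ex_borel_measurable_real[OF h0] by auto
  define c where "c = (\<lambda>s. \<integral>u. ?\<phi> (s - u) * g u \<partial>lborel)"
  have [measurable]: "c \<in> borel_measurable borel"
    unfolding c_def by measurable
  have mollify: "mollify \<Omega> \<xi> h = c"
  proof
    fix s
    have "mollify \<Omega> \<xi> h s = (\<integral>u. ?\<phi> (s - u) * h0 u \<partial>lebesgue)"
      by (simp add: mollify_def convolution_def h0_def)
    also have "\<dots> = (\<integral>u. ?\<phi> (s - u) * g u \<partial>lebesgue)"
    proof (rule integral_cong_AE)
      have [measurable]: "(\<lambda>u. ?\<phi> (s - u)) \<in> borel_measurable lebesgue" "g \<in> borel_measurable lebesgue"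
        by (rule measurable_completion, simp)+
      note h0[measurable]
      show "(\<lambda>u. ?\<phi> (s - u) * h0 u) \<in> borel_measurable lebesgue"
        "(\<lambda>u. ?\<phi> (s - u) * g u) \<in> borel_measurable lebesgue"
        by measurable
      show "AE u in lebesgue. ?\<phi> (s - u) * h0 u = ?\<phi> (s - u) * g u"
        using AE_completion[OF g] by eventually_elim simp
    qed
    also have "\<dots> = c s"
      unfolding c_def by (rule integral_completion) simp
    finally show "mollify \<Omega> \<xi> h s = c s" .
  qed
  have "(\<integral>\<^sup>+s. ennreal ((c s)\<^sup>2) \<partial>lebesgue_on \<Omega>) \<le> (\<integral>\<^sup>+s. ennreal ((c s)\<^sup>2) \<partial>lebesgue)"
    using \<Omega> by (subst nn_integral_restrict_space) (auto intro!: nn_integral_mono simp: indicator_def)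
  also have "\<dots> = (\<integral>\<^sup>+s. ennreal ((c s)\<^sup>2) \<partial>lborel)"
    by (rule nn_integral_completion)
  also have "\<dots> \<le> (\<integral>\<^sup>+s. \<integral>\<^sup>+u. ennreal (?\<phi> (s - u)) * ennreal ((g u)\<^sup>2) \<partial>lborel \<partial>lborel)"
    unfolding c_def using \<xi> by (intro nn_integral_mono convolution_scaled_mollifier_power2_le) auto
  also have "\<dots> = (\<integral>\<^sup>+u. \<integral>\<^sup>+s. ennreal (?\<phi> (s - u)) * ennreal ((g u)\<^sup>2) \<partial>lborel \<partial>lborel)"
    by (rule lborel_pair.Fubini') measurable
  also have "\<dots> = (\<integral>\<^sup>+u. ennreal ((g u)\<^sup>2) \<partial>lborel)"
    by (simp add: nn_integral_multc nn_integral_scaled_mollifier(2)[OF \<xi>])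
  also have "\<dots> = (\<integral>\<^sup>+u. ennreal ((h0 u)\<^sup>2) \<partial>lborel)"
    by (rule nn_integral_cong_AE) (use g in \<open>eventually_elim, simp\<close>)
  also have "\<dots> = (\<integral>\<^sup>+u. ennreal ((h0 u)\<^sup>2) \<partial>lebesgue)"
    by (rule nn_integral_completion[symmetric])
  also have "\<dots> = (\<integral>\<^sup>+u. ennreal ((h u)\<^sup>2) \<partial>lebesgue_on \<Omega>)"
    using \<Omega> by (subst nn_integral_restrict_space) (auto intro!: nn_integral_cong simp: h0_def indicator_def)
  also have "\<dots> = ennreal (\<integral>u. (h u)\<^sup>2 \<partial>lebesgue_on \<Omega>)"
    using L2_square_integrable[OF h] by (intro nn_integral_eq_integral) auto
  finally have le: "(\<integral>\<^sup>+s. ennreal ((c s)\<^sup>2) \<partial>lebesgue_on \<Omega>) \<le> ennreal (\<integral>u. (h u)\<^sup>2 \<partial>lebesgue_on \<Omega>)" .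
  have "c \<in> borel_measurable lebesgue"
    by (rule measurable_completion) simp
  then have "c \<in> borel_measurable (lebesgue_on \<Omega>)"
    by (rule measurable_restrict_space1)
  then have "(\<integral>s. (c s)\<^sup>2 \<partial>lebesgue_on \<Omega>) \<le> (\<integral>u. (h u)\<^sup>2 \<partial>lebesgue_on \<Omega>)"
    using enn2real_mono[OF le] by (subst integral_eq_nn_integral) auto
  then show ?thesis
    unfolding L2_norm_def mollify by (rule real_sqrt_le_mono)
qed

text \<open>The kernel is bounded, hence in L^2 of a set of finite measure, and a product of two L^2
  functions is integrable. Linearity of the convolution depends on this.\<close>

lemma mollify_integrable:
  assumes \<xi>: "0 < \<xi>" and h: "h \<in> L2 \<Omega>" and \<Omega>: "\<Omega> \<in> lmeasurable"
  shows "integrable lebesgue (\<lambda>u. scaled_mollifier \<xi> (s - u) * (if u \<in> \<Omega> then h u else 0))"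
proof -
  have "(\<lambda>u. scaled_mollifier \<xi> (s - u)) \<in> borel_measurable lebesgue"
    by (rule measurable_completion) simp
  then have "(\<lambda>u. scaled_mollifier \<xi> (s - u)) \<in> L2 \<Omega>"
    using \<Omega> scaled_mollifier_bounded[OF \<xi>] by (intro bounded_in_L2 measurable_restrict_space1) auto
  then have "integrable (lebesgue_on \<Omega>) (\<lambda>u. scaled_mollifier \<xi> (s - u) * h u)"
    using h by (rule L2_mult_integrable)
  then have "integrable lebesgue (\<lambda>u. indicator \<Omega> u *\<^sub>R (scaled_mollifier \<xi> (s - u) * h u))"
    using \<Omega> by (subst (asm) integrable_restrict_space) (auto simp: fmeasurableD)
  then show ?thesis
    by (rule Bochner_Integration.integrable_cong[THEN iffD1, rotated 2]) auto
qed

lemma mollify_diff: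
  assumes "0 < \<xi>" "f \<in> L2 \<Omega>" "g \<in> L2 \<Omega>" "\<Omega> \<in> lmeasurable"
  shows "mollify \<Omega> \<xi> (\<lambda>s. f s - g s) = (\<lambda>s. mollify \<Omega> \<xi> f s - mollify \<Omega> \<xi> g s)"
proof
  fix s
  have "mollify \<Omega> \<xi> (\<lambda>s. f s - g s) s
      = (\<integral>u. scaled_mollifier \<xi> (s - u) * (if u \<in> \<Omega> then f u else 0)
          - scaled_mollifier \<xi> (s - u) * (if u \<in> \<Omega> then g u else 0) \<partial>lebesgue)"
    unfolding mollify_def convolution_def
    by (intro Bochner_Integration.integral_cong) (auto simp: algebra_simps)
  also have "\<dots> = mollify \<Omega> \<xi> f s - mollify \<Omega> \<xi> g s"
    unfolding mollify_def convolution_def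
    using assms by (intro Bochner_Integration.integral_diff mollify_integrable)
  finally show "mollify \<Omega> \<xi> (\<lambda>s. f s - g s) s = mollify \<Omega> \<xi> f s - mollify \<Omega> \<xi> g s" .
qed

lemma L2_dist_mollify_le:
  assumes "0 < \<xi>" "f \<in> L2 \<Omega>" "g \<in> L2 \<Omega>" "\<Omega> \<in> lmeasurable"
  shows "L2_dist \<Omega> (mollify \<Omega> \<xi> f) (mollify \<Omega> \<xi> g) \<le> L2_dist \<Omega> f g"
  using L2_norm_mollify_le[OF assms(1) L2_diff[OF assms(2,3)]] assms
  by (simp add: L2_dist_def mollify_diff fmeasurableD)

section \<open>Density of sigmoidal sums\<close>

text \<open>Built by adding one multiple of a generator at a time, so that induction over the span
  needs no index sets and later turns directly into the growth of a network by one summand.\<close>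

inductive_set lin_span :: "('a \<Rightarrow> real) set \<Rightarrow> ('a \<Rightarrow> real) set" for B where
  zero: "(\<lambda>x. 0) \<in> lin_span B"
| step: "g \<in> lin_span B \<Longrightarrow> b \<in> B \<Longrightarrow> (\<lambda>x. g x + c * b x) \<in> lin_span B"

lemma lin_span_add:
  assumes "f \<in> lin_span B" "g \<in> lin_span B"
  shows "(\<lambda>x. f x + g x) \<in> lin_span B"
  using assms(2)
proof induction
  case (step g b c)
  then show ?case
    using lin_span.step[OF step.IH step.hyps(2), of c] by (simp add: add.assoc)
qed (simp add: assms(1))

lemma lin_span_scale:
  assumes "f \<in> lin_span B"
  shows "(\<lambda>x. a * f x) \<in> lin_span B"
  using assms
proof induction
  case (step g b c)
  then show ?case
    using lin_span.step[OF step.IH step.hyps(2), of "a * c"] by (simp add: algebra_simps)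
qed (simp add: lin_span.zero)

lemma lin_span_base: "b \<in> B \<Longrightarrow> b \<in> lin_span B"
  using lin_span.step[OF lin_span.zero, of b B 1] by simp

lemma lin_span_sum: "(\<And>i. i \<in> I \<Longrightarrow> f i \<in> lin_span B) \<Longrightarrow> (\<lambda>x. \<Sum>i\<in>I. f i x) \<in> lin_span B"
  by (induction I rule: infinite_finite_induct) (auto simp: lin_span.zero intro: lin_span_add)

text \<open>Bilinearity, by two nested inductions. The maps p and q cover two uses: as identities
  they give closure under pointwise products, as the two projections they give tensor products of
  functions of u and of t.\<close>

lemma lin_span_mult:
  assumes f: "f \<in> lin_span B" and g: "g \<in> lin_span B'"
    and mult: "\<And>b b'. b \<in> B \<Longrightarrow> b' \<in> B' \<Longrightarrow> (\<lambda>x. b (p x) * b' (q x)) \<in> B''"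
  shows "(\<lambda>x. f (p x) * g (q x)) \<in> lin_span B''"
  using f
proof induction
  case zero
  then show ?case
    by (simp add: lin_span.zero)
next
  case (step f b c)
  have "(\<lambda>x. b (p x) * g (q x)) \<in> lin_span B''"
    using g
  proof induction
    case zero
    then show ?case
      by (simp add: lin_span.zero)
  next
    case (step g b' c')
    then show ?case
      using lin_span.step[OF step.IH mult[OF \<open>b \<in> B\<close> step.hyps(2)], of c'] by (simp add: algebra_simps)
  qed
  then have "(\<lambda>x. f (p x) * g (q x) + c * (b (p x) * g (q x))) \<in> lin_span B''"
    using step.IH by (intro lin_span_add lin_span_scale)
  then show ?case
    by (simp add: algebra_simps)
qed

lemma lin_span_compose:
  assumes "g \<in> lin_span B" "\<And>b. b \<in> B \<Longrightarrow> (\<lambda>x. b (p x)) \<in> B'"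
  shows "(\<lambda>x. g (p x)) \<in> lin_span B'"
  using assms(1) by induction (auto intro: lin_span.intros assms(2))

text \<open>Reduces uniform approximation of a span to that of its generators, by splitting the
  error between the old sum and the new term.\<close>

lemma lin_span_approx:
  assumes "g \<in> lin_span B"
    and approx: "\<And>b e. b \<in> B \<Longrightarrow> 0 < e \<Longrightarrow> \<exists>h\<in>lin_span B'. \<forall>x\<in>K. \<bar>b x - h x\<bar> < e"
    and "0 < e"
  shows "\<exists>h\<in>lin_span B'. \<forall>x\<in>K. \<bar>g x - h x\<bar> < e"
  using assms(1,3)
proof (induction arbitrary: e)
  case zero
  then show ?case
    by (intro bexI[of _ "\<lambda>x. 0"]) (auto intro: lin_span.zero)
next
  case (step g b c)
  obtain h where h: "h \<in> lin_span B'" "\<forall>x\<in>K. \<bar>g x - h x\<bar> < e / 2"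
    using step.IH[of "e / 2"] step.prems by auto
  \<comment> \<open>Using \<bar>c\<bar> + 1 in place of \<bar>c\<bar> avoids division by
    zero.\<close>
  have c: "0 < \<bar>c\<bar> + 1"
    by simp
  obtain k where k: "k \<in> lin_span B'" "\<forall>x\<in>K. \<bar>b x - k x\<bar> < e / (2 * (\<bar>c\<bar> + 1))"
    using approx[OF step.hyps(2), of "e / (2 * (\<bar>c\<bar> + 1))"] step.prems c by auto
  show ?case
  proof (intro bexI ballI)
    show "(\<lambda>x. h x + c * k x) \<in> lin_span B'"
      using h k by (intro lin_span_add lin_span_scale)
    fix x
    assume x: "x \<in> K"
    have "\<bar>c * (b x - k x)\<bar> \<le> (\<bar>c\<bar> + 1) * \<bar>b x - k x\<bar>"
      by (simp add: abs_mult mult_right_mono)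
    also have "\<dots> \<le> (\<bar>c\<bar> + 1) * (e / (2 * (\<bar>c\<bar> + 1)))"
      using k x c by (intro mult_left_mono less_imp_le) auto
    also have "\<dots> = e / 2"
      using c by (simp add: field_simps)
    finally have "\<bar>c * (b x - k x)\<bar> \<le> e / 2" .
    moreover have "g x + c * b x - (h x + c * k x) = (g x - h x) + c * (b x - k x)"
      by (simp add: algebra_simps)
    moreover have "\<bar>g x - h x\<bar> < e / 2"
      using h x by blast
    ultimately show "\<bar>g x + c * b x - (h x + c * k x)\<bar> < e"
      by linarith
  qed
qed

section \<open>Uniform approximation by sigmoids\<close>

lemma sigmoid_pos:
  assumes "sigmoid \<sigma>"
  shows "0 < \<sigma> u"
proof -
  have "0 \<le> \<sigma> (u - 1)"
  proof (rule tendsto_upperbound)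
    show "(\<sigma> \<longlongrightarrow> 0) at_bot"
      using assms by (simp add: sigmoid_def)
    show "\<forall>\<^sub>F v in at_bot. \<sigma> v \<le> \<sigma> (u - 1)"
      using assms unfolding eventually_at_bot_linorder sigmoid_def by (meson strict_mono_less_eq)
  qed simp
  also have "\<sigma> (u - 1) < \<sigma> u"
    using assms by (simp add: sigmoid_def strict_mono_def)
  finally show ?thesis .
qed

lemma sigmoid_le_1:
  assumes "sigmoid \<sigma>"
  shows "\<sigma> u \<le> 1"
proof (rule tendsto_lowerbound)
  show "(\<sigma> \<longlongrightarrow> 1) at_top"
    using assms by (simp add: sigmoid_def)
  show "\<forall>\<^sub>F v in at_top. \<sigma> u \<le> \<sigma> v"
    using assms unfolding eventually_at_top_linorder sigmoid_def by (meson strict_mono_less_eq)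
qed simp

lemma sigmoid_continuous: "sigmoid \<sigma> \<Longrightarrow> continuous_on S \<sigma>"
  unfolding sigmoid_def
  by (meson continuous_at_imp_continuous_on differentiable_imp_continuous_within)

text \<open>Beyond some thresholds a and b the sigmoid is within \<delta> of its limits; the slope
  is chosen such that \<beta> h = max \<bar>a\<bar> \<bar>b\<bar>, which carries every argument
  outside (-h, h) past them.\<close>

lemma sigmoid_steep:
  assumes \<sigma>: "sigmoid \<sigma>" and "0 < h" "0 < \<delta>"
  obtains \<beta> where "\<And>t. h \<le> t \<Longrightarrow> \<bar>\<sigma> (\<beta> * t) - 1\<bar> \<le> \<delta>" "\<And>t. t \<le> - h \<Longrightarrow> \<bar>\<sigma> (\<beta> * t)\<bar> \<le> \<delta>"
proof -
  have "\<forall>\<^sub>F v in at_top. dist (\<sigma> v) 1 < \<delta>" "\<forall>\<^sub>F v in at_bot. dist (\<sigma> v) 0 < \<delta>"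
    using \<sigma> \<open>0 < \<delta>\<close> unfolding sigmoid_def tendsto_iff by auto
  then obtain a b where a: "\<And>v. a \<le> v \<Longrightarrow> \<bar>\<sigma> v - 1\<bar> < \<delta>" and b: "\<And>v. v \<le> b \<Longrightarrow> \<bar>\<sigma> v\<bar> < \<delta>"
    unfolding eventually_at_top_linorder eventually_at_bot_linorder by (auto simp: dist_real_def)
  define \<beta> where "\<beta> = max \<bar>a\<bar> \<bar>b\<bar> / h"
  have \<beta>: "0 \<le> \<beta>" "\<beta> * h = max \<bar>a\<bar> \<bar>b\<bar>"
    using \<open>0 < h\<close> by (auto simp: \<beta>_def)
  show ?thesis
  proof
    fix t
    show "\<bar>\<sigma> (\<beta> * t) - 1\<bar> \<le> \<delta>" if "h \<le> t"
      using a[of "\<beta> * t"] mult_left_mono[OF that \<beta>(1)] \<beta>(2) by linarith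
    show "\<bar>\<sigma> (\<beta> * t)\<bar> \<le> \<delta>" if "t \<le> - h"
      using b[of "\<beta> * t"] mult_left_mono[OF that \<beta>(1)] \<beta>(2) by (simp add: less_imp_le)
  qed
qed

text \<open>A continuous function is close to a step function on a fine grid, and each jump is imitated by
  a steep sigmoid; only the two grid points nearest to the argument contribute an error that does
  not vanish as the slope grows.\<close>

lemma sigmoid_dense_interval:
  fixes f :: "real \<Rightarrow> real"
  assumes \<sigma>: "sigmoid \<sigma>" and f: "continuous_on {a..b} f" and "a < b" "0 < e"
  shows "\<exists>g\<in>lin_span {\<lambda>z. \<sigma> (\<beta> * z + \<theta>) | \<beta> \<theta>. True}. \<forall>z\<in>{a..b}. \<bar>f z - g z\<bar> < e"
proof -
  let ?B = "{\<lambda>z. \<sigma> (\<beta> * z + \<theta>) | \<beta> \<theta>. True}"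
  \<comment> \<open>The error will be at most 3\<omega> from the sigmoids plus less than \<omega>
    from the step function, which is below 5\<omega>.\<close>
  define \<omega> where "\<omega> = e / 5"
  have \<omega>: "0 < \<omega>"
    using \<open>0 < e\<close> by (simp add: \<omega>_def)
  obtain d where d: "0 < d" "\<And>z z'. z \<in> {a..b} \<Longrightarrow> z' \<in> {a..b} \<Longrightarrow> \<bar>z' - z\<bar> < d \<Longrightarrow> \<bar>f z' - f z\<bar> < \<omega>"
    using compact_uniformly_continuous[OF f] \<omega>
    unfolding uniformly_continuous_on_def dist_real_def by (metis compact_Icc)
  obtain N :: nat where N: "(b - a) / d < N"
    using reals_Archimedean2 by blast
  have N0: "0 < real N"
    using N \<open>a < b\<close> d(1) by (meson diff_gt_0_iff_gt divide_pos_pos less_trans)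
  define h where "h = (b - a) / N"
  have h: "0 < h" "h < d" "a + N * h = b"
    using N N0 \<open>a < b\<close> d(1) by (auto simp: h_def field_simps)
  define z where "z = (\<lambda>i::nat. a + i * h)"
  have z_in: "z i \<in> {a..b}" if "i \<le> N" for i
    using that h mult_right_mono[of "real i" "real N" h] by (auto simp: z_def)
  define \<Delta> where "\<Delta> = (\<lambda>i. f (z (Suc i)) - f (z i))"
  have \<Delta>: "\<bar>\<Delta> i\<bar> \<le> \<omega>" if "i < N" for i
    unfolding \<Delta>_def using d(2)[OF z_in[of i] z_in[of "Suc i"]] that h by (simp add: z_def algebra_simps)
  \<comment> \<open>Tolerance 1 / N per jump: all N jumps, each of height at most \<omega>, together
    contribute at most \<omega>.\<close>
  obtain \<beta> where \<beta>: "\<And>t. h \<le> t \<Longrightarrow> \<bar>\<sigma> (\<beta> * t) - 1\<bar> \<le> 1 / N" "\<And>t. t \<le> - h \<Longrightarrow> \<bar>\<sigma> (\<beta> * t)\<bar> \<le> 1 / N"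
    using sigmoid_steep[OF \<sigma> h(1), of "1 / N"] N0 by (metis divide_pos_pos zero_less_one)
  \<comment> \<open>The constant f a is written as a sigmoid of slope zero, which uses that \<sigma>
    0 is positive. The jump \<Delta> i sits at the right end of its cell, so that the step function
    takes the value of f at the left grid point.\<close>
  define g where "g = (\<lambda>x. f a / \<sigma> 0 * \<sigma> (0 * x + 0) + (\<Sum>i<N. \<Delta> i * \<sigma> (\<beta> * x + (- \<beta> * z (Suc i)))))"
  show ?thesis
  proof (intro bexI ballI)
    show "g \<in> lin_span ?B"
      unfolding g_def by (intro lin_span_add lin_span_scale lin_span_sum lin_span_base) blast+
    fix x
    assume x: "x \<in> {a..b}"
    define j where "j = nat \<lfloor>(x - a) / h\<rfloor>"
    have j: "real j \<le> (x - a) / h" "(x - a) / h < real j + 1"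
      using x h(1) by (auto simp: j_def)
    then have zj: "z j \<le> x" "x < z (Suc j)"
      using h(1) by (auto simp: z_def field_simps)
    have "real j * h \<le> real N * h"
      using zj(1) x h(3) by (auto simp: z_def)
    then have jN: "j \<le> N"
      using h(1) by simp
    \<comment> \<open>The ideal step: jump i has been passed at x exactly if
      \<open>z (Suc i) \<le> x\<close>, that is, if i < j.\<close>
    define H where "H = (\<lambda>i. if i < j then 1 else 0 :: real)"
    have "(\<Sum>i<N. \<Delta> i * H i) = (\<Sum>i<j. \<Delta> i)"
      using jN by (intro sum.mono_neutral_cong_right) (auto simp: H_def)
    also have "\<dots> = f (z j) - f (z 0)"
      unfolding \<Delta>_def by (rule sum_lessThan_telescope)
    finally have "f a + (\<Sum>i<N. \<Delta> i * H i) = f (z j)"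
      by (simp add: z_def)
    moreover have "g x = f a + (\<Sum>i<N. \<Delta> i * \<sigma> (\<beta> * (x - z (Suc i))))"
      using sigmoid_pos[OF \<sigma>, of 0] by (simp add: g_def algebra_simps)
    ultimately have "g x - f (z j) = (\<Sum>i<N. \<Delta> i * (\<sigma> (\<beta> * (x - z (Suc i))) - H i))"
      by (simp add: algebra_simps sum_subtractf)
    \<comment> \<open>The exceptional indices are the jumps at \<open>z j\<close> and
      \<open>z (Suc j)\<close>, which enclose x; there only the trivial bound 1 holds. Every other
      jump is at least h away from x.\<close>
    also have "\<bar>\<dots>\<bar> \<le> (\<Sum>i<N. \<omega> * (1 / N + (if Suc i \<in> {j, Suc j} then 1 else 0)))"
    proof (rule order_trans[OF sum_abs sum_mono])
      fix i
      assume i: "i \<in> {..<N}"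
      let ?s = "\<sigma> (\<beta> * (x - z (Suc i)))"
      have "\<bar>?s - H i\<bar> \<le> 1 / N + (if Suc i \<in> {j, Suc j} then 1 else 0)"
      proof (cases "Suc i \<in> {j, Suc j}")
        case True
        have "\<bar>?s - H i\<bar> \<le> 1"
          using sigmoid_pos[OF \<sigma>, of "\<beta> * (x - z (Suc i))"] sigmoid_le_1[OF \<sigma>, of "\<beta> * (x - z (Suc i))"]
          by (auto simp: H_def)
        moreover have "0 \<le> 1 / real N"
          by simp
        ultimately have "\<bar>?s - H i\<bar> \<le> 1 / real N + 1"
          by linarith
        then show ?thesis
          using True by auto
      next
        case False
        then consider "Suc (Suc i) \<le> j" | "Suc (Suc j) \<le> Suc i"
          by fastforce
        then show ?thesis
        proof cases
          case 1
          then have "real (Suc (Suc i)) * h \<le> real j * h"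
            using h(1) by (intro mult_right_mono) auto
          then have "h \<le> x - z (Suc i)"
            using zj by (simp add: z_def algebra_simps)
          then show ?thesis
            using \<beta>(1) False 1 by (auto simp: H_def)
        next
          case 2
          then have "real (Suc (Suc j)) * h \<le> real (Suc i) * h"
            using h(1) by (intro mult_right_mono) auto
          then have "x - z (Suc i) \<le> - h"
            using zj by (simp add: z_def algebra_simps)
          then show ?thesis
            using \<beta>(2) False 2 by (auto simp: H_def)
        qed
      qed
      then show "\<bar>\<Delta> i * (?s - H i)\<bar> \<le> \<omega> * (1 / N + (if Suc i \<in> {j, Suc j} then 1 else 0))"
        unfolding abs_mult using \<Delta>[of i] i \<omega> by (intro mult_mono) auto
    qed
    also have "\<dots> = \<omega> * (1 + real (card {i. i < N \<and> Suc i \<in> {j, Suc j}}))"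
    proof -
      have "(\<Sum>i<N. if Suc i \<in> {j, Suc j} then 1 else 0::real) = real (card {i. i < N \<and> Suc i \<in> {j, Suc j}})"
        by (subst sum.inter_filter[symmetric]) auto
      then show ?thesis
        using N0 by (simp add: sum.distrib flip: sum_distrib_left)
    qed
    also have "\<dots> \<le> \<omega> * (1 + 2)"
    proof -
      \<comment> \<open>For j = 0 the truncated difference j - 1 is 0, and the inclusion still
        holds.\<close>
      have "card {i. i < N \<and> Suc i \<in> {j, Suc j}} \<le> card {j - 1, j}"
        by (rule card_mono) auto
      also have "\<dots> \<le> 2"
        by (simp add: card_insert_if)
      finally show ?thesis
        using \<omega> by (intro mult_left_mono add_left_mono) auto
    qed
    finally have "\<bar>g x - f (z j)\<bar> \<le> 3 * \<omega>"
      by simp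
    moreover have "\<bar>f x - f (z j)\<bar> < \<omega>"
      using zj h x z_in[OF jN] by (intro d(2)) (auto simp: z_def algebra_simps)
    ultimately show "\<bar>f x - g x\<bar> < e"
      using \<omega> unfolding \<omega>_def by linarith
  qed
qed

text \<open>Sums of exponentials of \<open>\<Phi>\<close> form an algebra, so the Stone-Weierstrass theorem reduces the
  claim to the approximation of \<open>exp\<close> on an interval.\<close>

lemma sigmoid_dense:
  fixes \<Phi> :: "('a::t2_space \<Rightarrow> real) set"
  assumes \<sigma>: "sigmoid \<sigma>" and K: "compact K" and f: "continuous_on K f" and "0 < e"
    and cont: "\<And>\<phi>. \<phi> \<in> \<Phi> \<Longrightarrow> continuous_on K \<phi>"
    and add: "\<And>\<phi> \<psi>. \<phi> \<in> \<Phi> \<Longrightarrow> \<psi> \<in> \<Phi> \<Longrightarrow> (\<lambda>x. \<phi> x + \<psi> x) \<in> \<Phi>"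
    and scale: "\<And>c \<phi>. \<phi> \<in> \<Phi> \<Longrightarrow> (\<lambda>x. c * \<phi> x) \<in> \<Phi>"
    and ne: "\<Phi> \<noteq> {}"
    and sep: "\<And>x y. x \<in> K \<Longrightarrow> y \<in> K \<Longrightarrow> x \<noteq> y \<Longrightarrow> \<exists>\<phi>\<in>\<Phi>. \<phi> x \<noteq> \<phi> y"
  shows "\<exists>g\<in>lin_span {\<lambda>x. \<sigma> (\<phi> x + \<theta>) | \<phi> \<theta>. \<phi> \<in> \<Phi>}. \<forall>x\<in>K. \<bar>f x - g x\<bar> < e"
proof -
  let ?E = "{\<lambda>x. exp (\<phi> x) | \<phi>. \<phi> \<in> \<Phi>}"
  let ?S = "{\<lambda>x. \<sigma> (\<phi> x + \<theta>) | \<phi> \<theta>. \<phi> \<in> \<Phi>}"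
  have zero: "(\<lambda>x. 0) \<in> \<Phi>"
    using ne scale[of _ 0] by auto
  interpret R: function_ring_on "lin_span ?E" K
  proof
    show "continuous_on K g" if "g \<in> lin_span ?E" for g
      using that
    proof induction
      case (step g b c)
      then obtain \<phi> where "\<phi> \<in> \<Phi>" "b = (\<lambda>x. exp (\<phi> x))"
        by auto
      then show ?case
        using continuous_on_add[OF step.IH continuous_on_mult_left[OF continuous_on_exp[OF cont]]] by auto
    qed simp
    show "(\<lambda>x. g x * h x) \<in> lin_span ?E" if "g \<in> lin_span ?E" "h \<in> lin_span ?E" for g h
    proof (rule lin_span_mult[OF that])
      fix b b'
      assume "b \<in> ?E" "b' \<in> ?E"
      then show "(\<lambda>x. b x * b' x) \<in> ?E"
        using add by (auto simp flip: exp_add)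
    qed
    \<comment> \<open>Constants are multiples of the exponential of the zero form.\<close>
    show "(\<lambda>_. c) \<in> lin_span ?E" for c
      using lin_span_scale[OF lin_span_base[of "\<lambda>x. exp 0" ?E], of c] zero by force
    show "\<exists>g\<in>lin_span ?E. g x \<noteq> g y" if xy: "x \<in> K" "y \<in> K" "x \<noteq> y" for x y
    proof -
      obtain \<phi> where "\<phi> \<in> \<Phi>" "\<phi> x \<noteq> \<phi> y"
        using sep[OF xy] by blast
      then show ?thesis
        by (intro bexI[of _ "\<lambda>x. exp (\<phi> x)"] lin_span_base) auto
    qed
  qed (auto intro: K lin_span_add)
  have exp_approx: "\<exists>g\<in>lin_span ?S. \<forall>x\<in>K. \<bar>b x - g x\<bar> < d" if b: "b \<in> ?E" and "0 < d" for b d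
  proof -
    obtain \<phi> where \<phi>: "\<phi> \<in> \<Phi>" "b = (\<lambda>x. exp (\<phi> x))"
      using b by auto
    have "bounded (\<phi> ` K)"
      using K cont[OF \<phi>(1)] by (intro compact_imp_bounded compact_continuous_image)
    then obtain B where B: "\<And>x. x \<in> K \<Longrightarrow> \<bar>\<phi> x\<bar> \<le> B"
      by (auto simp: bounded_iff)
    \<comment> \<open>The ends are \<bar>B\<bar> + 1 rather than B, so that the interval is
      nondegenerate even for \<phi> = 0 or empty K.\<close>
    have "\<exists>g\<in>lin_span {\<lambda>z. \<sigma> (\<beta> * z + \<theta>) | \<beta> \<theta>. True}.
        \<forall>z\<in>{-(\<bar>B\<bar> + 1)..\<bar>B\<bar> + 1}. \<bar>exp z - g z\<bar> < d"
      by (rule sigmoid_dense_interval[OF \<sigma> continuous_on_exp[OF continuous_on_id] _ \<open>0 < d\<close>]) simp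
    then obtain g where g: "g \<in> lin_span {\<lambda>z. \<sigma> (\<beta> * z + \<theta>) | \<beta> \<theta>. True}"
      "\<forall>z\<in>{-(\<bar>B\<bar> + 1)..\<bar>B\<bar> + 1}. \<bar>exp z - g z\<bar> < d"
      by blast
    show ?thesis
    proof (intro bexI ballI)
      show "(\<lambda>x. g (\<phi> x)) \<in> lin_span ?S"
      proof (rule lin_span_compose[OF g(1)])
        fix b'
        assume "b' \<in> {\<lambda>z. \<sigma> (\<beta> * z + \<theta>) | \<beta> \<theta>. True}"
        then obtain \<beta> \<theta> where "b' = (\<lambda>z. \<sigma> (\<beta> * z + \<theta>))"
          by blast
        then show "(\<lambda>x. b' (\<phi> x)) \<in> ?S"
          using scale[OF \<phi>(1), of \<beta>] by auto
      qed
      show "\<bar>b x - g (\<phi> x)\<bar> < d" if "x \<in> K" for x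
        using g(2) B[OF that] \<phi>(2) by fastforce
    qed
  qed
  obtain g where g: "g \<in> lin_span ?E" "\<forall>x\<in>K. \<bar>f x - g x\<bar> < e / 2"
    using R.Stone_Weierstrass_basic[OF f, of "e / 2"] \<open>0 < e\<close> by auto
  obtain h where h: "h \<in> lin_span ?S" "\<forall>x\<in>K. \<bar>g x - h x\<bar> < e / 2"
    using lin_span_approx[OF g(1) exp_approx half_gt_zero[OF \<open>0 < e\<close>]] by blast
  show ?thesis
  proof (intro bexI ballI)
    show "\<bar>f x - h x\<bar> < e" if "x \<in> K" for x
      using bspec[OF g(2) that] bspec[OF h(2) that] by linarith
  qed (rule h(1))
qed

section \<open>From uniform approximation to approximation in L^2\<close>

lemma L2_dist_tendsto_zero:
  assumes f: "f \<in> L2 \<Omega>" and g: "\<And>n. g n \<in> L2 \<Omega>" and h: "h \<in> L2 \<Omega>"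
    and lim: "AE s in lebesgue_on \<Omega>. (\<lambda>n. g n s) \<longlonglongrightarrow> f s"
    and bound: "\<And>n. AE s in lebesgue_on \<Omega>. \<bar>f s - g n s\<bar> \<le> \<bar>h s\<bar>"
  shows "(\<lambda>n. L2_dist \<Omega> f (g n)) \<longlonglongrightarrow> 0"
proof -
  have "(\<lambda>n. \<integral>s. (f s - g n s)\<^sup>2 \<partial>lebesgue_on \<Omega>) \<longlonglongrightarrow> (\<integral>s. 0 \<partial>lebesgue_on \<Omega>)"
  proof (rule integral_dominated_convergence)
    show "(\<lambda>s. (f s - g n s)\<^sup>2) \<in> borel_measurable (lebesgue_on \<Omega>)" for n
      using L2_square_integrable[OF L2_diff[OF f g]] by (rule borel_measurable_integrable)
    show "integrable (lebesgue_on \<Omega>) (\<lambda>s. (h s)\<^sup>2)"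
      using h by (rule L2_square_integrable)
    show "AE s in lebesgue_on \<Omega>. (\<lambda>n. (f s - g n s)\<^sup>2) \<longlonglongrightarrow> 0"
      using lim
    proof eventually_elim
      case (elim s)
      have "(\<lambda>n. (f s - g n s)\<^sup>2) \<longlonglongrightarrow> (f s - f s)\<^sup>2"
        by (intro tendsto_intros elim)
      then show ?case
        by simp
    qed
    show "AE s in lebesgue_on \<Omega>. norm ((f s - g n s)\<^sup>2) \<le> (h s)\<^sup>2" for n
      using bound[of n] by eventually_elim (simp add: abs_le_square_iff)
  qed simp
  then have "(\<lambda>n. sqrt (\<integral>s. (f s - g n s)\<^sup>2 \<partial>lebesgue_on \<Omega>)) \<longlonglongrightarrow> sqrt 0"
    by (intro tendsto_real_sqrt) simp
  then show ?thesis
    by (simp add: L2_dist_def L2_norm_def)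
qed

text \<open>Truncation serves twice: it replaces an L^2 function by a bounded one, and it gives
  continuous approximants a common majorant without destroying continuity.\<close>

definition clip :: "real \<Rightarrow> real \<Rightarrow> real" where
  "clip B v = max (- B) (min B v)"

lemma clip_abs_le: "0 \<le> B \<Longrightarrow> \<bar>clip B v\<bar> \<le> B"
  by (auto simp: clip_def)

lemma clip_diff_le: "0 \<le> B \<Longrightarrow> \<bar>v - clip B v\<bar> \<le> \<bar>v\<bar>"
  by (auto simp: clip_def)

lemma clip_eq: "\<bar>v\<bar> \<le> B \<Longrightarrow> clip B v = v"
  by (auto simp: clip_def)

lemma clip_measurable [measurable]: "clip B \<in> borel_measurable borel"
  unfolding clip_def[abs_def] by measurable

lemma clip_tendsto: "(f \<longlongrightarrow> l) F \<Longrightarrow> ((\<lambda>x. clip B (f x)) \<longlongrightarrow> clip B l) F"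
  unfolding clip_def by (intro tendsto_intros)

text \<open>Dominated convergence, twice: f is the limit of its truncations, with majorant f itself;
  a truncation at height m is the limit of continuous functions truncated at the same height, with
  majorant 2 m.\<close>

lemma continuous_dense_L2:
  fixes \<Omega> :: "'a::euclidean_space set"
  assumes \<Omega>: "\<Omega> \<in> lmeasurable" and f: "f \<in> L2 \<Omega>" and e: "0 < e"
  obtains g where "continuous_on UNIV g" "g \<in> L2 \<Omega>" "L2_dist \<Omega> f g < e"
proof -
  note fm = L2_measurable[OF f]
  have tr: "(\<lambda>s. clip B (f s)) \<in> L2 \<Omega>" if "0 \<le> B" for B
    using fm clip_abs_le[OF that]
    by (intro bounded_in_L2[OF \<Omega>]) (auto intro: measurable_compose[OF _ clip_measurable])
  have "(\<lambda>n. L2_dist \<Omega> f (\<lambda>s. clip (real n) (f s))) \<longlonglongrightarrow> 0"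
  proof (rule L2_dist_tendsto_zero[OF f tr f])
    have "(\<lambda>n. clip (real n) (f s)) \<longlonglongrightarrow> f s" for s
    proof (rule tendsto_eventually)
      obtain m :: nat where "\<bar>f s\<bar> \<le> real m"
        using real_arch_simple by blast
      then show "\<forall>\<^sub>F n in sequentially. clip (real n) (f s) = f s"
        by (auto intro!: eventually_sequentiallyI[of m] clip_eq)
    qed
    then show "AE s in lebesgue_on \<Omega>. (\<lambda>n. clip (real n) (f s)) \<longlonglongrightarrow> f s"
      by simp
  qed (auto simp: clip_diff_le)
  then have "\<forall>\<^sub>F n in sequentially. L2_dist \<Omega> f (\<lambda>s. clip (real n) (f s)) < e / 2"
    using e by (intro order_tendstoD) auto
  then obtain m :: nat where m: "L2_dist \<Omega> f (\<lambda>s. clip (real m) (f s)) < e / 2"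
    by (meson eventually_sequentially order_refl)
  \<comment> \<open>Lebesgue measurability in the form \<open>measurable_on\<close>: continuous
    functions on the whole space converge off a negligible set to the extension by zero.\<close>
  obtain N g where N: "negligible N" and g: "\<And>n. continuous_on UNIV (g n)"
    and lim: "\<And>s. s \<notin> N \<Longrightarrow> (\<lambda>n. g n s) \<longlonglongrightarrow> (if s \<in> \<Omega> then f s else 0)"
    using fm measurable_on_iff_borel_measurable[of \<Omega> f] \<Omega> unfolding measurable_on_def
    by (auto simp: fmeasurableD)
  define k where "k = (\<lambda>n s. clip (real m) (g n s))"
  have kc: "continuous_on UNIV (k n)" for n
    unfolding k_def clip_def using g[of n] by (intro continuous_intros)
  have kL: "k n \<in> L2 \<Omega>" for n
  proof (rule bounded_in_L2[OF \<Omega>])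
    show "k n \<in> borel_measurable (lebesgue_on \<Omega>)"
      using kc[of n] \<Omega>
      by (intro continuous_imp_measurable_on_sets_lebesgue continuous_on_subset[OF kc]) (auto simp: fmeasurableD)
    show "\<bar>k n s\<bar> \<le> real m" for s
      unfolding k_def by (rule clip_abs_le) simp
  qed
  have "(\<lambda>n. L2_dist \<Omega> (\<lambda>s. clip (real m) (f s)) (k n)) \<longlonglongrightarrow> 0"
  proof (rule L2_dist_tendsto_zero)
    show "(\<lambda>s. 2 * real m) \<in> L2 \<Omega>"
      by (rule bounded_in_L2[OF \<Omega>]) auto
    have "AE s in lebesgue. s \<notin> N"
      using N by (simp add: negligible_iff_null_sets AE_not_in)
    then have "AE s in lebesgue. s \<in> \<Omega> \<longrightarrow> (\<lambda>n. k n s) \<longlonglongrightarrow> clip (real m) (f s)"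
    proof eventually_elim
      case (elim s)
      then show ?case
        using clip_tendsto[OF lim[OF elim], of "real m"] by (auto simp: k_def)
    qed
    then show "AE s in lebesgue_on \<Omega>. (\<lambda>n. k n s) \<longlonglongrightarrow> clip (real m) (f s)"
      using \<Omega> by (subst AE_restrict_space_iff) (auto simp: fmeasurableD)
    show "AE s in lebesgue_on \<Omega>. \<bar>clip (real m) (f s) - k n s\<bar> \<le> \<bar>2 * real m\<bar>" for n
    proof (rule AE_I2)
      fix s
      show "\<bar>clip (real m) (f s) - k n s\<bar> \<le> \<bar>2 * real m\<bar>"
        unfolding k_def
        using clip_abs_le[of "real m" "f s"] clip_abs_le[of "real m" "g n s"] by simp
    qed
  qed (use tr kL in auto)
  then have "\<forall>\<^sub>F n in sequentially. L2_dist \<Omega> (\<lambda>s. clip (real m) (f s)) (k n) < e / 2"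
    using e by (intro order_tendstoD) auto
  then obtain n where n: "L2_dist \<Omega> (\<lambda>s. clip (real m) (f s)) (k n) < e / 2"
    by (meson eventually_sequentially order_refl)
  have "L2_dist \<Omega> f (k n) < e"
    using L2_dist_triangle[OF f tr[of "real m"] kL[of n]] m n by simp
  then show thesis
    using that kc kL by blast
qed

lemma continuous_in_L2:
  assumes "\<Omega> \<in> lmeasurable" "bounded \<Omega>" "continuous_on UNIV g"
  shows "g \<in> L2 \<Omega>"
proof -
  have "bounded (g ` closure \<Omega>)"
    using assms by (intro compact_imp_bounded compact_continuous_image) (auto intro: continuous_on_subset)
  then obtain B where "\<And>s. s \<in> closure \<Omega> \<Longrightarrow> \<bar>g s\<bar> \<le> B"
    by (auto simp: bounded_iff)
  then show ?thesis
    using assms closure_subset[of \<Omega>]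
    by (intro bounded_in_L2[of _ _ B] continuous_imp_measurable_on_sets_lebesgue)
      (auto simp: fmeasurableD intro: continuous_on_subset)
qed

text \<open>A continuous function is interposed: it is L^2-close to f, and uniform approximation of
  it on the compact closure of \<open>\<Omega>\<close> is L^2 approximation up to the root of the
  measure, which V bounds.\<close>

lemma sigmoid_dense_L2:
  fixes \<Omega> :: "'a::euclidean_space set"
  assumes \<sigma>: "sigmoid \<sigma>" and \<Omega>: "\<Omega> \<in> lmeasurable" "bounded \<Omega>" and f: "f \<in> L2 \<Omega>" and e: "0 < e"
  shows "\<exists>g\<in>lin_span {\<lambda>t. \<sigma> (w \<bullet> t + \<zeta>) | w \<zeta>. True}. g \<in> L2 \<Omega> \<and> L2_dist \<Omega> f g < e"
proof -
  let ?S = "{\<lambda>t. \<sigma> (w \<bullet> t + \<zeta>) | (w::'a) \<zeta>. True}"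
  let ?\<Phi> = "{\<lambda>t. w \<bullet> t | w::'a. True}"
  obtain k where k: "continuous_on UNIV k" "k \<in> L2 \<Omega>" "L2_dist \<Omega> f k < e / 2"
    using continuous_dense_L2[OF \<Omega>(1) f, of "e / 2"] e by auto
  define V where "V = sqrt (measure lebesgue \<Omega>) + 1"
  have V: "0 < V"
    by (simp add: V_def add_nonneg_pos)
  have "\<exists>g\<in>lin_span {\<lambda>x. \<sigma> (\<phi> x + \<theta>) | \<phi> \<theta>. \<phi> \<in> ?\<Phi>}. \<forall>x\<in>closure \<Omega>. \<bar>k x - g x\<bar> < e / 2 / V"
  proof (rule sigmoid_dense[OF \<sigma>])
    show "continuous_on (closure \<Omega>) k"
      using k(1) by (rule continuous_on_subset) simp
    show "(\<lambda>x. \<phi> x + \<psi> x) \<in> ?\<Phi>" if "\<phi> \<in> ?\<Phi>" "\<psi> \<in> ?\<Phi>" for \<phi> \<psi>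
    proof -
      from that obtain v w where "\<phi> = (\<lambda>t. v \<bullet> t)" "\<psi> = (\<lambda>t. w \<bullet> t)"
        by auto
      then have "(\<lambda>x. \<phi> x + \<psi> x) = (\<lambda>t. (v + w) \<bullet> t)"
        by (simp add: inner_add_left)
      then show ?thesis
        by blast
    qed
    show "(\<lambda>x. c * \<phi> x) \<in> ?\<Phi>" if "\<phi> \<in> ?\<Phi>" for c \<phi>
    proof -
      from that obtain v where "\<phi> = (\<lambda>t. v \<bullet> t)"
        by auto
      then have "(\<lambda>x. c * \<phi> x) = (\<lambda>t. (c *\<^sub>R v) \<bullet> t)"
        by simp
      then show ?thesis
        by blast
    qed
    \<comment> \<open>The form with direction x - y separates: its values at x and y differ by the
      squared norm of x - y.\<close>
    show "\<exists>\<phi>\<in>?\<Phi>. \<phi> x \<noteq> \<phi> y" if "x \<noteq> y" for x y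
      using that by (auto simp: inner_eq_zero_iff[of "x - y"] inner_diff_right
          intro!: bexI[of _ "\<lambda>t. (x - y) \<bullet> t"]) (metis eq_iff_diff_eq_0 inner_diff_right inner_eq_zero_iff)
    show "continuous_on (closure \<Omega>) \<phi>" if "\<phi> \<in> ?\<Phi>" for \<phi>
      using that by (auto intro: continuous_on_inner continuous_on_const continuous_on_id)
  qed (use \<Omega>(2) e V in auto)
  moreover have "{\<lambda>x. \<sigma> (\<phi> x + \<theta>) | \<phi> \<theta>. \<phi> \<in> ?\<Phi>} = ?S"
    by auto
  ultimately obtain g where g: "g \<in> lin_span ?S" "\<forall>x\<in>closure \<Omega>. \<bar>k x - g x\<bar> < e / 2 / V"
    by auto
  have "continuous_on UNIV g"
    using g(1)
  proof induction
    case (step g b c)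
    then obtain w \<zeta> where "b = (\<lambda>t. \<sigma> (w \<bullet> t + \<zeta>))"
      by auto
    moreover have "continuous_on UNIV (\<lambda>t. w \<bullet> t + \<zeta>)"
      by (intro continuous_on_add continuous_on_inner continuous_on_const continuous_on_id)
    ultimately have "continuous_on UNIV b"
      using continuous_on_compose2[OF sigmoid_continuous[OF \<sigma>, of UNIV]] by simp
    with step.IH show ?case
      by (intro continuous_intros)
  qed simp
  then have gL: "g \<in> L2 \<Omega>"
    by (rule continuous_in_L2[OF \<Omega>])
  have "L2_dist \<Omega> k g \<le> e / 2 / V * sqrt (measure lebesgue \<Omega>)"
    unfolding L2_dist_def
  proof (rule L2_norm_le_bound[OF \<Omega>(1) L2_measurable[OF L2_diff[OF k(2) gL]]])
    show "\<bar>k s - g s\<bar> \<le> e / 2 / V" if "s \<in> \<Omega>" for s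
      using g(2) that closure_subset by (meson less_imp_le subsetD)
  qed (use e V in simp)
  also have "\<dots> \<le> e / 2 / V * V"
    using e V by (intro mult_left_mono) (auto simp: V_def)
  also have "\<dots> = e / 2"
    using V by simp
  finally have "L2_dist \<Omega> f g < e"
    using L2_dist_triangle[OF f k(2) gL] k(3) by simp
  then show ?thesis
    using g(1) gL by blast
qed

section \<open>Neural operators\<close>

definition point_evaluations :: "'a set \<Rightarrow> (('a \<Rightarrow> real) \<Rightarrow> real) set" where
  "point_evaluations \<Omega> = {\<lambda>u. u s | s. s \<in> \<Omega>}"

text \<open>Brings a form into the shape of the inner sum of \<open>neural_operator\<close>, with
  indices from 1. Nodes may repeat, and the zero form has L = 0.\<close>

lemma lin_span_point_evaluations_sum:
  assumes "\<phi> \<in> lin_span (point_evaluations \<Omega>)"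
  obtains L :: nat and w s where "\<And>l. l \<in> {1..L} \<Longrightarrow> s l \<in> \<Omega>" "\<And>u. \<phi> u = (\<Sum>l=1..L. w l * u (s l))"
proof -
  have "\<exists>(L::nat) w s. (\<forall>l\<in>{1..L}. s l \<in> \<Omega>) \<and> (\<forall>u. \<phi> u = (\<Sum>l=1..L. w l * u (s l)))"
    using assms
  proof induction
    case zero
    then show ?case
      by (intro exI[of _ "0::nat"]) auto
  next
    case (step \<phi> b c)
    obtain L :: nat and w s where IH: "\<forall>l\<in>{1..L}. s l \<in> \<Omega>" "\<forall>u. \<phi> u = (\<Sum>l=1..L. w l * u (s l))"
      using step.IH by blast
    obtain p where p: "p \<in> \<Omega>" "b = (\<lambda>u. u p)"
      using step.hyps(2) by (auto simp: point_evaluations_def)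
    have "(\<Sum>l=1..Suc L. (w(Suc L := c)) l * u ((s(Suc L := p)) l)) = (\<Sum>l=1..L. w l * u (s l)) + c * u p"
      for u
    proof -
      have "(\<Sum>l=1..L. (w(Suc L := c)) l * u ((s(Suc L := p)) l)) = (\<Sum>l=1..L. w l * u (s l))"
        by (rule sum.cong) auto
      then show ?thesis
        by simp
    qed
    then show ?case
      using IH p
      by (intro exI[of _ "Suc L"] exI[of _ "w(Suc L := c)"] exI[of _ "s(Suc L := p)"]) auto
  qed
  then show thesis
    using that by blast
qed

text \<open>A generator is one summand of a neural operator with coefficient 1, so the span
  corresponds to operators with K = 1. The inner form is left abstract, since different summands may
  use different nodes.\<close>

definition neural_terms ::
    "(real \<Rightarrow> real) \<Rightarrow> 'a set \<Rightarrow> (('a \<Rightarrow> real) \<times> 'b::euclidean_space \<Rightarrow> real) set" where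
  "neural_terms \<sigma> \<Omega> = {\<lambda>(u, t). \<sigma> (\<phi> u + \<theta>) * \<sigma> (w \<bullet> t + \<zeta>) | \<phi> \<theta> w \<zeta>.
     \<phi> \<in> lin_span (point_evaluations \<Omega>)}"

lemma sum_add_split: "(\<Sum>l=1..L + L'. f l) = (\<Sum>l=1..L. f l) + (\<Sum>l=1..L'. f (L + l))"
  for f :: "nat \<Rightarrow> real"
  by (induction L') (auto simp: add.assoc)

text \<open>A new term extends \<open>J\<close> by one and appends its own nodes; it has zero weight at the old nodes, and
  the old terms have zero weight at the new nodes.\<close>

lemma lin_span_neural_terms_imp_neural_operator:
  fixes G :: "(real ^ 'm::finite \<Rightarrow> real) \<times> (real ^ 'n::finite) \<Rightarrow> real"
  assumes "G \<in> lin_span (neural_terms \<sigma> \<Omega>)" and ne: "\<Omega> \<noteq> {}"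
  shows "\<exists>T :: ('m, 'n) neural_coeffs. neural_coeffs_on \<Omega> T \<and> dim_K T = 1 \<and>
    (\<forall>u t. G (u, t) = neural_operator \<sigma> T u t)"
  using assms(1)
proof induction
  case zero
  \<comment> \<open>J, K and L must be at least 1, so even the zero function takes one summand, with
    coefficient 0, and a node.\<close>
  obtain p where "p \<in> \<Omega>"
    using ne by blast
  then show ?case
    by (intro exI[of _ "\<lparr>dim_J = 1, dim_K = 1, dim_L = 1, alpha = \<lambda>_ _. 0, weight = \<lambda>_ _ _. 0,
        direction = \<lambda>_. 0, theta = \<lambda>_ _. 0, node = \<lambda>_. p, zeta = \<lambda>_. 0\<rparr>"])
      (auto simp: neural_coeffs_on_def neural_operator_def)
next
  case (step G b c)
  obtain T :: "('m, 'n) neural_coeffs" where T: "neural_coeffs_on \<Omega> T" "dim_K T = 1"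
    "\<forall>u t. G (u, t) = neural_operator \<sigma> T u t"
    using step.IH by blast
  obtain \<phi> \<theta> v \<zeta> where \<phi>: "\<phi> \<in> lin_span (point_evaluations \<Omega>)"
    and b: "b = (\<lambda>(u, t). \<sigma> (\<phi> u + \<theta>) * \<sigma> (v \<bullet> t + \<zeta>))"
    using step.hyps(2) by (auto simp: neural_terms_def)
  obtain L' :: nat and w s where s: "\<And>l. l \<in> {1..L'} \<Longrightarrow> s l \<in> \<Omega>"
    and w: "\<And>u. \<phi> u = (\<Sum>l=1..L'. w l * u (s l))"
    by (rule lin_span_point_evaluations_sum[OF \<phi>]) (rule that)
  define J where "J = dim_J T"
  define L where "L = dim_L T"
  define T' :: "('m, 'n) neural_coeffs" where "T' = \<lparr>dim_J = Suc J, dim_K = 1, dim_L = L + L',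
    alpha = \<lambda>j k. if j \<le> J then alpha T j k else c,
    weight = \<lambda>j k l. if j \<le> J then (if l \<le> L then weight T j k l else 0)
      else (if l \<le> L then 0 else w (l - L)),
    direction = \<lambda>j. if j \<le> J then direction T j else v,
    theta = \<lambda>j k. if j \<le> J then theta T j k else \<theta>,
    node = \<lambda>l. if l \<le> L then node T l else s (l - L),
    zeta = \<lambda>j. if j \<le> J then zeta T j else \<zeta>\<rparr>"
  have old: "(\<Sum>l=1..L + L'. weight T' j 1 l * u (node T' l)) = (\<Sum>l=1..L. weight T j 1 l * u (node T l))"
    if "j \<le> J" for j u
  proof -
    have "(\<Sum>l=1..L. weight T' j 1 l * u (node T' l)) = (\<Sum>l=1..L. weight T j 1 l * u (node T l))"
      using that by (intro sum.cong) (auto simp: T'_def)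
    moreover have "(\<Sum>l=1..L'. weight T' j 1 (L + l) * u (node T' (L + l))) = 0"
      using that by (intro sum.neutral) (auto simp: T'_def)
    ultimately show ?thesis
      by (simp only: sum_add_split)
  qed
  have new: "(\<Sum>l=1..L + L'. weight T' (Suc J) 1 l * u (node T' l)) = \<phi> u" for u
  proof -
    have "(\<Sum>l=1..L. weight T' (Suc J) 1 l * u (node T' l)) = 0"
      by (intro sum.neutral) (auto simp: T'_def)
    moreover have "(\<Sum>l=1..L'. weight T' (Suc J) 1 (L + l) * u (node T' (L + l))) = \<phi> u"
      unfolding w by (intro sum.cong) (auto simp: T'_def)
    ultimately show ?thesis
      by (simp only: sum_add_split)
  qed
  have dims: "dim_J T' = Suc J" "dim_K T' = 1" "dim_L T' = L + L'"
    by (simp_all add: T'_def)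
  have op: "neural_operator \<sigma> S u t = (\<Sum>j=1..dim_J S. alpha S j 1
      * \<sigma> ((\<Sum>l=1..dim_L S. weight S j 1 l * u (node S l)) + theta S j 1) * \<sigma> (direction S j \<bullet> t + zeta S j))"
    if "dim_K S = 1" for S :: "('m, 'n) neural_coeffs" and u t
    using that by (simp add: neural_operator_def)
  have "G (u, t) + c * b (u, t) = neural_operator \<sigma> T' u t" for u t
  proof -
    have "(\<Sum>j=1..J. alpha T' j 1 * \<sigma> ((\<Sum>l=1..L + L'. weight T' j 1 l * u (node T' l)) + theta T' j 1)
          * \<sigma> (direction T' j \<bullet> t + zeta T' j))
        = (\<Sum>j=1..J. alpha T j 1 * \<sigma> ((\<Sum>l=1..L. weight T j 1 l * u (node T l)) + theta T j 1)
          * \<sigma> (direction T j \<bullet> t + zeta T j))"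
      by (intro sum.cong) (simp_all only: atLeastAtMost_iff old, simp add: T'_def)
    moreover have "alpha T' (Suc J) 1 = c" "theta T' (Suc J) 1 = \<theta>" "direction T' (Suc J) = v" "zeta T' (Suc J) = \<zeta>"
      by (simp_all add: T'_def)
    ultimately show ?thesis
      unfolding op[OF dims(2)] dims using new[of u]
      by (simp add: T(3)[rule_format] op[OF T(2)] b J_def L_def)
  qed
  moreover have "neural_coeffs_on \<Omega> T'"
    unfolding neural_coeffs_on_def
  proof (intro conjI ballI)
    fix l
    assume l: "l \<in> {1..dim_L T'}"
    show "node T' l \<in> \<Omega>"
    proof (cases "l \<le> L")
      case True
      then show ?thesis
        using l T(1) by (auto simp: T'_def L_def neural_coeffs_on_def)
    next
      case False
      then have "l - L \<in> {1..L'}"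
        using l by (auto simp: dims)
      then show ?thesis
        using False s by (simp add: T'_def)
    qed
  qed (use T(1) in \<open>auto simp: dims L_def neural_coeffs_on_def\<close>)
  ultimately show ?case
    using dims(2) by blast
qed

text \<open>Evaluation of \<open>u \<circ> q\<close> at an index n is evaluation of u at the node
  \<open>q n\<close>, so a network reading sequences becomes one reading functions at points of
  \<open>\<Omega>\<close>.\<close>

lemma lin_span_neural_terms_reindex:
  assumes "G \<in> lin_span (neural_terms \<sigma> I)" and q: "q ` I \<subseteq> \<Omega>"
  shows "(\<lambda>(u, t). G (u \<circ> q, t)) \<in> lin_span (neural_terms \<sigma> \<Omega>)"
  unfolding case_prod_beta
proof (rule lin_span_compose[OF assms(1)])
  fix b :: "('a \<Rightarrow> real) \<times> 'b::euclidean_space \<Rightarrow> real"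
  assume "b \<in> neural_terms \<sigma> I"
  then obtain \<phi> \<theta> w \<zeta> where \<phi>: "\<phi> \<in> lin_span (point_evaluations I)"
    and b: "b = (\<lambda>(u, t). \<sigma> (\<phi> u + \<theta>) * \<sigma> (w \<bullet> t + \<zeta>))"
    by (auto simp: neural_terms_def)
  have "(\<lambda>u. \<phi> (u \<circ> q)) \<in> lin_span (point_evaluations \<Omega>)"
  proof (rule lin_span_compose[OF \<phi>])
    fix b :: "('a \<Rightarrow> real) \<Rightarrow> real"
    assume "b \<in> point_evaluations I"
    then obtain s where "s \<in> I" "b = (\<lambda>u. u s)"
      by (auto simp: point_evaluations_def)
    then show "(\<lambda>u. b (u \<circ> q)) \<in> point_evaluations \<Omega>"
      using q unfolding point_evaluations_def by (intro CollectI exI[of _ "q s"]) auto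
  qed
  then show "(\<lambda>x. b (fst x \<circ> q, snd x)) \<in> neural_terms \<sigma> \<Omega>"
    unfolding neural_terms_def case_prod_beta b
    by (intro CollectI exI[of _ "\<lambda>u. \<phi> (u \<circ> q)"] exI[of _ \<theta>] exI[of _ w] exI[of _ \<zeta>]) simp
qed

text \<open>The values of \<open>F\<close> on the compact set \<open>K\<close> are glued from finitely many of them by a partition of
  unity; then the weights are approximated uniformly on \<open>K\<close> and the values in \<open>L\<^sup>2(\<Omega>)\<close>.\<close>

lemma neural_approximation:
  fixes F :: "('a::countable \<Rightarrow> real) \<Rightarrow> 'b::euclidean_space \<Rightarrow> real"
  assumes \<sigma>: "sigmoid \<sigma>" and \<Omega>: "\<Omega> \<in> lmeasurable" "bounded \<Omega>"
    and K: "compact K" and sep: "\<And>u v. u \<in> K \<Longrightarrow> v \<in> K \<Longrightarrow> u \<noteq> v \<Longrightarrow> \<exists>s\<in>\<Omega>'. u s \<noteq> v s"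
    and F: "\<And>u. u \<in> K \<Longrightarrow> F u \<in> L2 \<Omega>"
    and cont: "\<And>w. w \<in> K \<Longrightarrow> continuous_on K (\<lambda>v. L2_dist \<Omega> (F v) (F w))"
    and \<epsilon>: "0 < \<epsilon>"
  shows "\<exists>G\<in>lin_span (neural_terms \<sigma> \<Omega>'). \<forall>u\<in>K. (\<lambda>t. G (u, t)) \<in> L2 \<Omega> \<and> L2_dist \<Omega> (F u) (\<lambda>t. G (u, t)) \<le> \<epsilon>"
proof -
  let ?\<Phi> = "lin_span (point_evaluations \<Omega>') :: (('a \<Rightarrow> real) \<Rightarrow> real) set"
  let ?S = "{\<lambda>u. \<sigma> (\<phi> u + \<theta>) | \<phi> \<theta>. \<phi> \<in> ?\<Phi>}"
  let ?R = "{\<lambda>t. \<sigma> (w \<bullet> t + \<zeta>) | (w::'b) \<zeta>. True}"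
  \<comment> \<open>One third each for the gluing, for the approximation of the \<open>F w\<close>,
    and for that of the weights.\<close>
  define e where "e = \<epsilon> / 3"
  have e: "0 < e"
    using \<epsilon> by (simp add: e_def)
  define p where "p = (\<lambda>v w. L2_dist \<Omega> (F v) (F w))"
  have p_cont: "continuous_on K (\<lambda>v. p v w)" if "w \<in> K" for w
    using cont[OF that] by (simp add: p_def)
  define U where "U = (\<lambda>w. K \<inter> (\<lambda>v. p v w) -` {..<e})"
  have "openin (top_of_set K) (U w)" if "w \<in> K" for w
    unfolding U_def using p_cont[OF that] by (rule continuous_openin_preimage_gen) simp
  moreover have "K \<subseteq> (\<Union>w\<in>K. U w)"
    using e by (auto simp: U_def p_def L2_dist_refl)
  ultimately have "\<exists>\<U>\<subseteq>U ` K. finite \<U> \<and> K \<subseteq> \<Union>\<U>"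
    using compact_eq_openin_cover[THEN iffD1, OF K, THEN spec, of "U ` K"] by auto
  then obtain W where W: "W \<subseteq> K" "finite W" and cover: "K \<subseteq> (\<Union>w\<in>W. U w)"
    by (metis finite_subset_image)
  \<comment> \<open>On K, \<open>\<psi> w\<close> is positive exactly on \<open>U w\<close>; as the
    sets \<open>U w\<close> cover K, the sum is positive and can be normalized.\<close>
  define \<psi> where "\<psi> = (\<lambda>w v. max 0 (e - p v w))"
  define \<eta> where "\<eta> = (\<lambda>w v. \<psi> w v / (\<Sum>w\<in>W. \<psi> w v))"
  have \<psi>: "0 \<le> \<psi> w v" for w v
    by (simp add: \<psi>_def)
  have sum_pos: "0 < (\<Sum>w\<in>W. \<psi> w v)" if v: "v \<in> K" for v
  proof -
    obtain w where "w \<in> W" "v \<in> U w"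
      using cover v by blast
    then show ?thesis
      using W(2) \<psi> by (intro sum_pos2[of W w]) (auto simp: U_def \<psi>_def)
  qed
  have \<eta>_nonneg: "0 \<le> \<eta> w v" for w v
    unfolding \<eta>_def using \<psi> by (intro divide_nonneg_nonneg sum_nonneg) auto
  have \<eta>_sum: "(\<Sum>w\<in>W. \<eta> w v) = 1" if "v \<in> K" for v
    unfolding \<eta>_def using sum_pos[OF that] by (simp flip: sum_divide_distrib)
  \<comment> \<open>The weight of w vanishes at every v with \<open>p v w > e\<close>, so only
    values of \<open>F\<close> that are e-close are averaged.\<close>
  have \<eta>_p: "\<eta> w v * p v w \<le> \<eta> w v * e" for w v
  proof (cases "p v w \<le> e")
    case True
    then show ?thesis
      using \<eta>_nonneg by (intro mult_left_mono) auto
  qed (simp add: \<eta>_def \<psi>_def)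
  have \<psi>_cont: "continuous_on K (\<psi> w)" if "w \<in> W" for w
    unfolding \<psi>_def using p_cont[of w] that W(1) by (intro continuous_intros) auto
  have \<eta>_cont: "continuous_on K (\<eta> w)" if "w \<in> W" for w
    unfolding \<eta>_def using \<psi>_cont that sum_pos
    by (intro continuous_on_divide continuous_on_sum) (auto simp: less_imp_neq[symmetric])
  have "\<forall>w\<in>W. \<exists>g. g \<in> lin_span ?R \<and> g \<in> L2 \<Omega> \<and> L2_dist \<Omega> (F w) g < e"
  proof
    fix w
    assume "w \<in> W"
    then have "F w \<in> L2 \<Omega>"
      using W(1) F by blast
    from sigmoid_dense_L2[OF \<sigma> \<Omega> this e] show "\<exists>g. g \<in> lin_span ?R \<and> g \<in> L2 \<Omega> \<and> L2_dist \<Omega> (F w) g < e"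
      by blast
  qed
  from bchoice[OF this] obtain g where g: "\<And>w. w \<in> W \<Longrightarrow> g w \<in> lin_span ?R" "\<And>w. w \<in> W \<Longrightarrow> g w \<in> L2 \<Omega>"
    "\<And>w. w \<in> W \<Longrightarrow> L2_dist \<Omega> (F w) (g w) < e"
    by blast
  \<comment> \<open>The weight errors e / N are multiplied by the norms of the \<open>g w\<close>,
    which add up to N - 1; the summand 1 keeps N positive.\<close>
  define N where "N = (\<Sum>w\<in>W. L2_norm \<Omega> (g w)) + 1"
  have N: "0 < N"
    by (auto simp: N_def intro!: add_nonneg_pos sum_nonneg L2_norm_nonneg)
  have h_ex: "\<exists>h\<in>lin_span ?S. \<forall>v\<in>K. \<bar>\<eta> w v - h v\<bar> < e / N" if "w \<in> W" for w
  proof (rule sigmoid_dense[OF \<sigma> K \<eta>_cont[OF that]])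
    show "continuous_on K \<phi>" if "\<phi> \<in> ?\<Phi>" for \<phi>
      using that
    proof induction
      case (step \<phi> b c)
      then obtain s where "b = (\<lambda>u. u s)"
        by (auto simp: point_evaluations_def)
      then have "continuous_on K b"
        using continuous_on_subset[OF continuous_on_product_coordinates] by simp
      then show ?case
        by (intro continuous_on_add step.IH continuous_on_mult_left)
    qed simp
    show "\<exists>\<phi>\<in>?\<Phi>. \<phi> u \<noteq> \<phi> v" if uv: "u \<in> K" "v \<in> K" "u \<noteq> v" for u v
    proof -
      obtain s where "s \<in> \<Omega>'" "u s \<noteq> v s"
        using sep[OF uv] by blast
      then show ?thesis
        by (intro bexI[of _ "\<lambda>u. u s"] lin_span_base) (auto simp: point_evaluations_def)
    qed
    show "?\<Phi> \<noteq> {}"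
      using lin_span.zero by blast
  qed (use e N in \<open>auto intro: lin_span_add lin_span_scale\<close>)
  have "\<forall>w\<in>W. \<exists>h. h \<in> lin_span ?S \<and> (\<forall>v\<in>K. \<bar>\<eta> w v - h v\<bar> < e / N)"
    using h_ex by blast
  from bchoice[OF this] obtain h where h: "\<And>w. w \<in> W \<Longrightarrow> h w \<in> lin_span ?S"
    "\<And>w v. w \<in> W \<Longrightarrow> v \<in> K \<Longrightarrow> \<bar>\<eta> w v - h w v\<bar> < e / N"
    by blast
  define G where "G = (\<lambda>x. \<Sum>w\<in>W. h w (fst x) * g w (snd x))"
  have "(\<lambda>x. h w (fst x) * g w (snd x)) \<in> lin_span (neural_terms \<sigma> \<Omega>')" if w: "w \<in> W" for w
  proof (rule lin_span_mult[where p = fst and q = snd, OF h(1)[OF w] g(1)[OF w]])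
    fix b b'
    assume "b \<in> ?S" "b' \<in> ?R"
    then obtain \<phi> \<theta> v \<zeta> where "\<phi> \<in> ?\<Phi>" "b = (\<lambda>u. \<sigma> (\<phi> u + \<theta>))" "b' = (\<lambda>t. \<sigma> (v \<bullet> t + \<zeta>))"
      by blast
    then show "(\<lambda>x. b (fst x) * b' (snd x)) \<in> neural_terms \<sigma> \<Omega>'"
      unfolding neural_terms_def case_prod_beta by blast
  qed
  then have "G \<in> lin_span (neural_terms \<sigma> \<Omega>')"
    unfolding G_def by (rule lin_span_sum)
  moreover have "(\<lambda>t. G (u, t)) \<in> L2 \<Omega> \<and> L2_dist \<Omega> (F u) (\<lambda>t. G (u, t)) \<le> \<epsilon>" if u: "u \<in> K" for u
  proof
    show "(\<lambda>t. G (u, t)) \<in> L2 \<Omega>"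
      unfolding G_def fst_conv snd_conv by (rule L2_sum) (rule L2_scale[OF g(2)])
    \<comment> \<open>The three errors for one w. Summed over w they give
      \<open>F u - G (u, _)\<close>, because the weights add up to 1 on K.\<close>
    let ?t = "\<lambda>w t. \<eta> w u * (F u t - F w t) + \<eta> w u * (F w t - g w t) + (\<eta> w u - h w u) * g w t"
    have LF: "F u \<in> L2 \<Omega>" "\<And>w. w \<in> W \<Longrightarrow> F w \<in> L2 \<Omega>"
      using F u W(1) by auto
    have summand: "?t w \<in> L2 \<Omega> \<and> L2_norm \<Omega> (?t w) \<le> \<eta> w u * e + \<eta> w u * e + e / N * L2_norm \<Omega> (g w)"
      if w: "w \<in> W" for w
    proof -
      have a: "(\<lambda>t. \<eta> w u * (F u t - F w t)) \<in> L2 \<Omega>"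
        and b: "(\<lambda>t. \<eta> w u * (F w t - g w t)) \<in> L2 \<Omega>"
        and c: "(\<lambda>t. (\<eta> w u - h w u) * g w t) \<in> L2 \<Omega>"
        by (rule L2_scale[OF L2_diff[OF LF(1) LF(2)[OF w]]] L2_scale[OF L2_diff[OF LF(2)[OF w] g(2)[OF w]]]
            L2_scale[OF g(2)[OF w]])+
      have "L2_norm \<Omega> (?t w) \<le> L2_norm \<Omega> (\<lambda>t. \<eta> w u * (F u t - F w t))
          + L2_norm \<Omega> (\<lambda>t. \<eta> w u * (F w t - g w t)) + L2_norm \<Omega> (\<lambda>t. (\<eta> w u - h w u) * g w t)"
        using L2_norm_triangle[OF L2_add[OF a b] c] L2_norm_triangle[OF a b] by linarith
      also have "\<dots> = \<eta> w u * p u w + \<eta> w u * L2_dist \<Omega> (F w) (g w) + \<bar>\<eta> w u - h w u\<bar> * L2_norm \<Omega> (g w)"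
        using \<eta>_nonneg[of w u] by (simp only: L2_norm_scale abs_of_nonneg p_def L2_dist_def)
      also have "\<dots> \<le> \<eta> w u * e + \<eta> w u * e + e / N * L2_norm \<Omega> (g w)"
        by (intro add_mono \<eta>_p mult_left_mono[OF less_imp_le[OF g(3)[OF w]] \<eta>_nonneg]
            mult_right_mono[OF less_imp_le[OF h(2)[OF w u]] L2_norm_nonneg])
      finally show ?thesis
        using L2_add[OF L2_add[OF a b] c] by blast
    qed
    have "F u t - G (u, t) = (\<Sum>w\<in>W. ?t w t)" for t
    proof -
      have "(\<Sum>w\<in>W. ?t w t) = (\<Sum>w\<in>W. \<eta> w u * F u t - h w u * g w t)"
        by (intro sum.cong) (simp_all add: algebra_simps)
      also have "\<dots> = (\<Sum>w\<in>W. \<eta> w u) * F u t - G (u, t)"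
        by (simp add: sum_subtractf G_def flip: sum_distrib_right)
      finally show ?thesis
        using \<eta>_sum[OF u] by simp
    qed
    then have "L2_dist \<Omega> (F u) (\<lambda>t. G (u, t)) = L2_norm \<Omega> (\<lambda>t. \<Sum>w\<in>W. ?t w t)"
      by (simp add: L2_dist_def)
    also have "\<dots> \<le> (\<Sum>w\<in>W. L2_norm \<Omega> (?t w))"
      using summand W(2) by (intro L2_norm_sum_le) auto
    also have "\<dots> \<le> (\<Sum>w\<in>W. \<eta> w u * e + \<eta> w u * e + e / N * L2_norm \<Omega> (g w))"
      using summand by (intro sum_mono) auto
    also have "\<dots> = e + e + e / N * (N - 1)"
    proof -
      have "(\<Sum>w\<in>W. L2_norm \<Omega> (g w)) = N - 1"
        by (simp add: N_def)
      then show ?thesis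
        unfolding sum.distrib sum_distrib_left[symmetric] sum_distrib_right[symmetric] \<eta>_sum[OF u] by simp
    qed
    also have "\<dots> \<le> e + e + e / N * N"
      using e N by (intro add_left_mono mult_left_mono) auto
    also have "\<dots> = \<epsilon>"
      using N by (simp add: e_def)
    finally show "L2_dist \<Omega> (F u) (\<lambda>t. G (u, t)) \<le> \<epsilon>" .
  qed
  ultimately show ?thesis
    by blast
qed

section \<open>Transfer to the compact set of mollified functions\<close>

lemma regular_bounded_domainD:
  assumes "regular_bounded_domain \<Omega>"
  shows "open \<Omega>" "bounded \<Omega>" "\<Omega> \<noteq> {}" "\<Omega> \<in> lmeasurable"
  using assms by (auto simp: regular_bounded_domain_def lmeasurable_open)

lemma L2_operator_onD:
  assumes "L2_operator \<Omega>\<^sub>X \<Omega>\<^sub>Y D F" "f \<in> D"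
  shows "f \<in> L2 \<Omega>\<^sub>X" "F f \<in> L2 \<Omega>\<^sub>Y"
  using assms by (auto simp: L2_operator_def L2_subset_def)

lemma L2_dist_diff_le:
  assumes "f \<in> L2 \<Omega>" "g \<in> L2 \<Omega>" "h \<in> L2 \<Omega>"
  shows "\<bar>L2_dist \<Omega> f h - L2_dist \<Omega> g h\<bar> \<le> L2_dist \<Omega> f g"
  using L2_dist_triangle[OF assms] L2_dist_triangle[OF assms(2,1,3)] L2_dist_commute[of \<Omega> f g] by linarith

lemma mollify_C_eq_on: "s \<in> \<Omega> \<Longrightarrow> mollify_C \<Omega> \<xi> x s = mollify \<Omega> \<xi> x s"
  using closure_subset[of \<Omega>] by (auto simp: mollify_C_def)

lemma L2_eq_mollify_C:
  assumes "\<Omega> \<in> sets lebesgue"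
  shows "L2_eq \<Omega> (mollify \<Omega> \<xi> x) (mollify_C \<Omega> \<xi> x)"
  unfolding L2_eq_def using assms by (intro AE_I2) (simp add: mollify_C_eq_on)

lemma L2_cong_on:
  assumes "f \<in> L2 \<Omega>" "\<And>s. s \<in> \<Omega> \<Longrightarrow> g s = f s"
  shows "g \<in> L2 \<Omega>"
proof -
  have "g \<in> borel_measurable (lebesgue_on \<Omega>) \<longleftrightarrow> f \<in> borel_measurable (lebesgue_on \<Omega>)"
    by (rule measurable_cong) (simp add: assms(2))
  moreover have "integrable (lebesgue_on \<Omega>) (\<lambda>s. (g s)\<^sup>2) \<longleftrightarrow> integrable (lebesgue_on \<Omega>) (\<lambda>s. (f s)\<^sup>2)"
    by (rule Bochner_Integration.integrable_cong) (simp_all add: assms(2))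
  ultimately show ?thesis
    using assms(1) by (simp add: L2_def)
qed

text \<open>Turns continuity of \<open>F\<close> in L^2 into continuity for the supremum metric, in
  which the mollified functions are compact.\<close>

lemma L2_dist_le_C_closure:
  assumes \<Omega>: "\<Omega> \<in> lmeasurable" and ne: "\<Omega> \<noteq> {}"
    and uv: "u \<in> mspace (C_closure \<Omega>)" "v \<in> mspace (C_closure \<Omega>)" "u \<in> L2 \<Omega>" "v \<in> L2 \<Omega>"
  shows "L2_dist \<Omega> u v \<le> mdist (C_closure \<Omega>) u v * sqrt (measure lebesgue \<Omega>)"
  unfolding L2_dist_def
proof (rule L2_norm_le_bound[OF \<Omega> L2_measurable[OF L2_diff[OF uv(3,4)]]])
  show "\<bar>u s - v s\<bar> \<le> mdist (C_closure \<Omega>) u v" if "s \<in> \<Omega>" for s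
    using mdist_cfunspace_imp_mdist_le[of u "top_of_set (closure \<Omega>)" euclidean_metric v] uv that closure_subset[of \<Omega>]
    by (auto simp: C_closure_def dist_real_def)
qed simp

text \<open>A compact set of \<open>C(closure \<Omega>)\<close> is homeomorphic to the set of its restrictions to a dense sequence
  in \<open>\<Omega>\<close>, where pointwise convergence is metrizable and the Stone-Weierstrass theorem is available.\<close>

lemma C_closure_compact_restriction:
  fixes q :: "nat \<Rightarrow> 'a::euclidean_space"
  assumes K: "compactin (mtopology_of (C_closure \<Omega>)) K" and q: "range q \<subseteq> \<Omega>" "\<Omega> \<subseteq> closure (range q)"
  shows "compact ((\<lambda>u. u \<circ> q) ` K)" and "inj_on (\<lambda>u. u \<circ> q) K"
    and "continuous_map (subtopology (mtopology_of (C_closure \<Omega>)) K) euclideanreal p \<Longrightarrow>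
      continuous_on ((\<lambda>u. u \<circ> q) ` K) (p \<circ> the_inv_into K (\<lambda>u. u \<circ> q))"
proof -
  let ?T = "mtopology_of (C_closure \<Omega>)" and ?r = "\<lambda>u. u \<circ> q"
  have K_sub: "K \<subseteq> mspace (C_closure \<Omega>)"
    using compactin_subset_topspace[OF K] by simp
  have eval: "continuous_map ?T euclideanreal (\<lambda>u. u s)" if "s \<in> closure \<Omega>" for s
  proof -
    have "Lipschitz_continuous_map (C_closure \<Omega>) euclidean_metric (\<lambda>u. u s)"
      unfolding Lipschitz_continuous_map_def
    proof (intro conjI exI[of _ 1] ballI)
      fix u v
      assume "u \<in> mspace (C_closure \<Omega>)" "v \<in> mspace (C_closure \<Omega>)"
      then show "mdist euclidean_metric (u s) (v s) \<le> 1 * mdist (C_closure \<Omega>) u v"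
        using mdist_cfunspace_imp_mdist_le[of u "top_of_set (closure \<Omega>)" euclidean_metric v _ s] that
        by (simp add: C_closure_def)
    qed simp
    then show ?thesis
      using Lipschitz_continuous_imp_continuous_map by fastforce
  qed
  have q_cl: "q n \<in> closure \<Omega>" for n
    using q(1) closure_subset[of \<Omega>] by blast
  have "continuous_map ?T (product_topology (\<lambda>_::nat. euclideanreal) UNIV) ?r"
    using eval[OF q_cl] by (simp add: continuous_map_componentwise_UNIV)
  then have r: "continuous_map ?T euclidean ?r"
    by (simp only: euclidean_product_topology)
  show compact: "compact (?r ` K)"
    using image_compactin[OF K r] by simp
  show inj: "inj_on ?r K"
  proof (rule inj_onI)
    fix u v
    assume uv: "u \<in> K" "v \<in> K" and eq: "u \<circ> q = v \<circ> q"
    have cont: "continuous_on (closure \<Omega>) w" and ext: "w \<in> extensional (closure \<Omega>)" if "w \<in> K" for w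
      using K_sub that by (auto simp: C_closure_def)
    have cl: "closure \<Omega> = closure (range q)"
      using q by (metis closure_closure closure_mono subset_antisym)
    \<comment> \<open>Continuous functions that agree on the dense range of q agree on the closure
      of \<open>\<Omega>\<close>; being extensional, they are then equal.\<close>
    have "u s - v s = 0" if "s \<in> closure \<Omega>" for s
    proof (rule continuous_constant_on_closure[of "range q" "\<lambda>s. u s - v s"])
      show "continuous_on (closure (range q)) (\<lambda>s. u s - v s)"
        using cont uv unfolding cl by (intro continuous_on_diff) auto
      show "u t - v t = 0" if "t \<in> range q" for t
        using eq that by (auto simp: fun_eq_iff)
      show "s \<in> closure (range q)"
        using that cl by simp
    qed
    then show "u = v"
      using ext uv by (intro extensionalityI[of _ "closure \<Omega>"]) auto
  qed
  have top: "topspace (subtopology ?T K) = K"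
    using K_sub by auto
  \<comment> \<open>A continuous bijection from a compact space to a Hausdorff space is a
    homeomorphism; its inverse carries continuous functions on K to the set of sequences.\<close>
  have "homeomorphic_map (subtopology ?T K) (top_of_set (?r ` K)) ?r"
  proof (rule continuous_imp_homeomorphic_map)
    show "continuous_map (subtopology ?T K) (top_of_set (?r ` K)) ?r"
      using continuous_map_from_subtopology[OF r] top by (intro continuous_map_into_subtopology) auto
    show "compact_space (subtopology ?T K)"
      using K by (rule compact_space_subtopology)
    show "Hausdorff_space (top_of_set (?r ` K))"
      by (intro Hausdorff_space_subtopology Hausdorff_space_euclidean)
  qed (use top inj in auto)
  then obtain g where g: "homeomorphic_maps (subtopology ?T K) (top_of_set (?r ` K)) ?r g"
    unfolding homeomorphic_map_maps by blast
  assume "continuous_map (subtopology ?T K) euclideanreal p"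
  then have "continuous_on (?r ` K) (p \<circ> g)"
    using g continuous_map_compose unfolding homeomorphic_maps_def by (metis continuous_map_iff_continuous)
  moreover have "g z = the_inv_into K ?r z" if "z \<in> ?r ` K" for z
    using g that the_inv_into_f_f[OF inj] top unfolding homeomorphic_maps_def by auto
  ultimately show "continuous_on (?r ` K) (p \<circ> the_inv_into K ?r)"
    by (simp cong: continuous_on_cong)
qed

text \<open>\<open>F\<close> is carried to the compact set of sequences by the inverse of the
  restriction map and approximated there; the network found reads a function only at the points
  \<open>q n\<close>, hence at nodes in the domain.\<close>

lemma neural_operator_approximation:
  fixes F :: "(real ^ 'm::finite \<Rightarrow> real) \<Rightarrow> (real ^ 'n::finite \<Rightarrow> real)"
  assumes \<sigma>: "sigmoid \<sigma>" and \<Omega>\<^sub>X: "regular_bounded_domain \<Omega>\<^sub>X" and \<Omega>\<^sub>Y: "regular_bounded_domain \<Omega>\<^sub>Y"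
    and F: "L2_operator \<Omega>\<^sub>X \<Omega>\<^sub>Y D F" and cont: "L2_continuous_on \<Omega>\<^sub>X \<Omega>\<^sub>Y D F"
    and K: "compactin (mtopology_of (C_closure \<Omega>\<^sub>X)) K" and KD: "K \<subseteq> D" and \<epsilon>: "0 < \<epsilon>"
  shows "\<exists>T :: ('m, 'n) neural_coeffs. neural_coeffs_on \<Omega>\<^sub>X T \<and>
    (\<forall>u\<in>K. neural_operator \<sigma> T u \<in> L2 \<Omega>\<^sub>Y \<and> L2_dist \<Omega>\<^sub>Y (F u) (neural_operator \<sigma> T u) \<le> \<epsilon>)"
proof -
  note X = regular_bounded_domainD[OF \<Omega>\<^sub>X] and Y = regular_bounded_domainD[OF \<Omega>\<^sub>Y]
  have K_sub: "K \<subseteq> mspace (C_closure \<Omega>\<^sub>X)"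
    using compactin_subset_topspace[OF K] by simp
  have KL: "u \<in> L2 \<Omega>\<^sub>X" "F u \<in> L2 \<Omega>\<^sub>Y" if "u \<in> K" for u
    using L2_operator_onD[OF F] KD that by blast+
  obtain Q where Q: "countable Q" "Q \<subseteq> \<Omega>\<^sub>X" "\<Omega>\<^sub>X \<subseteq> closure Q"
    by (rule separable)
  then have "Q \<noteq> {}"
    using X(3) by auto
  define q where "q = from_nat_into Q"
  have q: "range q = Q"
    unfolding q_def using \<open>Q \<noteq> {}\<close> Q(1) by (rule range_from_nat_into)
  let ?r = "\<lambda>u. u \<circ> q"
  note restr = C_closure_compact_restriction[OF K, of q, unfolded q, OF Q(2,3)]
  \<comment> \<open>Continuity of \<open>F\<close> enters through real functions, since the distance
    of representatives is only a pseudometric. Uniformly close arguments are L^2-close, and the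
    distance to a fixed \<open>F w\<close> is 1-Lipschitz.\<close>
  have p_cont: "continuous_map (subtopology (mtopology_of (C_closure \<Omega>\<^sub>X)) K) euclideanreal
      (\<lambda>v. L2_dist \<Omega>\<^sub>Y (F v) (F w))" if w: "w \<in> K" for w
  proof -
    define V where "V = sqrt (measure lebesgue \<Omega>\<^sub>X) + 1"
    have V: "0 < V"
      by (simp add: V_def add_nonneg_pos)
    have "continuous_map (mtopology_of (submetric (C_closure \<Omega>\<^sub>X) K)) (mtopology_of euclidean_metric)
        (\<lambda>v. L2_dist \<Omega>\<^sub>Y (F v) (F w))"
      unfolding mtopology_of_def
    proof (subst Metric_space.metric_continuous_map, safe)
      fix v and e :: real
      assume v: "v \<in> mspace (submetric (C_closure \<Omega>\<^sub>X) K)" and e: "0 < e"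
      then have vK: "v \<in> K"
        by simp
      then obtain d where d: "0 < d"
        "\<And>v'. v' \<in> D \<Longrightarrow> L2_dist \<Omega>\<^sub>X v' v < d \<Longrightarrow> L2_dist \<Omega>\<^sub>Y (F v') (F v) < e"
        using cont e KD unfolding L2_continuous_on_def by (meson subsetD)
      show "\<exists>\<delta>>0. \<forall>v'. v' \<in> mspace (submetric (C_closure \<Omega>\<^sub>X) K) \<and>
          mdist (submetric (C_closure \<Omega>\<^sub>X) K) v v' < \<delta> \<longrightarrow>
          mdist euclidean_metric (L2_dist \<Omega>\<^sub>Y (F v) (F w)) (L2_dist \<Omega>\<^sub>Y (F v') (F w)) < e"
      proof (intro exI conjI allI impI)
        show "0 < d / V"
          using d V by simp
        fix v'
        assume "v' \<in> mspace (submetric (C_closure \<Omega>\<^sub>X) K) \<and> mdist (submetric (C_closure \<Omega>\<^sub>X) K) v v' < d / V"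
        then have v'K: "v' \<in> K" and lt: "mdist (C_closure \<Omega>\<^sub>X) v v' < d / V"
          by auto
        have "L2_dist \<Omega>\<^sub>X v v' \<le> mdist (C_closure \<Omega>\<^sub>X) v v' * sqrt (measure lebesgue \<Omega>\<^sub>X)"
          using K_sub vK v'K KL by (intro L2_dist_le_C_closure[OF X(4,3)]) auto
        also have "\<dots> \<le> mdist (C_closure \<Omega>\<^sub>X) v v' * V"
          by (intro mult_left_mono) (auto simp: V_def)
        also have "\<dots> < d"
          using lt V by (simp add: pos_less_divide_eq)
        finally have "L2_dist \<Omega>\<^sub>Y (F v') (F v) < e"
          using d(2) v'K KD by (auto simp: L2_dist_commute)
        then show "mdist euclidean_metric (L2_dist \<Omega>\<^sub>Y (F v) (F w)) (L2_dist \<Omega>\<^sub>Y (F v') (F w)) < e"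
          using L2_dist_diff_le[OF KL(2)[OF v'K] KL(2)[OF vK] KL(2)[OF w]]
          by (simp add: dist_real_def abs_minus_commute)
      qed
    qed auto
    then show ?thesis
      by (simp add: mtopology_of_submetric)
  qed
  have inv: "the_inv_into K ?r (?r u) = u" if "u \<in> K" for u
    using restr(2) that by (rule the_inv_into_f_f)
  have "\<exists>G\<in>lin_span (neural_terms \<sigma> (UNIV :: nat set)). \<forall>z\<in>?r ` K. (\<lambda>t. G (z, t)) \<in> L2 \<Omega>\<^sub>Y \<and>
      L2_dist \<Omega>\<^sub>Y (F (the_inv_into K ?r z)) (\<lambda>t. G (z, t)) \<le> \<epsilon>"
  proof (rule neural_approximation[OF \<sigma> Y(4,2) restr(1)])
    show "\<exists>s\<in>UNIV. u s \<noteq> v s" if "u \<noteq> v" for u v :: "nat \<Rightarrow> real"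
      using that by auto
    show "F (the_inv_into K ?r z) \<in> L2 \<Omega>\<^sub>Y" if "z \<in> ?r ` K" for z
      using that inv KL by auto
    show "continuous_on (?r ` K) (\<lambda>z. L2_dist \<Omega>\<^sub>Y (F (the_inv_into K ?r z)) (F (the_inv_into K ?r z')))"
      if "z' \<in> ?r ` K" for z'
    proof -
      have "the_inv_into K ?r z' \<in> K"
        using that inv by auto
      from restr(3)[OF p_cont[OF this]] show ?thesis
        by (simp add: o_def)
    qed
  qed (rule \<epsilon>)
  then obtain G where G: "G \<in> lin_span (neural_terms \<sigma> (UNIV :: nat set))"
    "\<And>u. u \<in> K \<Longrightarrow> (\<lambda>t. G (u \<circ> q, t)) \<in> L2 \<Omega>\<^sub>Y \<and> L2_dist \<Omega>\<^sub>Y (F u) (\<lambda>t. G (u \<circ> q, t)) \<le> \<epsilon>"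
    using inv by fastforce
  have "(\<lambda>(u, t). G (u \<circ> q, t)) \<in> lin_span (neural_terms \<sigma> \<Omega>\<^sub>X)"
    using G(1) q Q(2) by (intro lin_span_neural_terms_reindex) auto
  from lin_span_neural_terms_imp_neural_operator[OF this X(3)]
  obtain T :: "('m, 'n) neural_coeffs" where T: "neural_coeffs_on \<Omega>\<^sub>X T"
    "\<And>u t. G (u \<circ> q, t) = neural_operator \<sigma> T u t"
    by auto
  then have "neural_operator \<sigma> T u = (\<lambda>t. G (u \<circ> q, t))" for u
    by auto
  then show ?thesis
    using T(1) G(2) by auto
qed

text \<open>All nodes lie in \<open>\<Omega>\<close>, so an operator does not distinguish
  \<open>mollify\<close> from its restriction \<open>mollify_C\<close>.\<close>

lemma neural_operator_cong:
  assumes "neural_coeffs_on \<Omega> T" "\<And>s. s \<in> \<Omega> \<Longrightarrow> u s = v s"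
  shows "neural_operator \<sigma> T u = neural_operator \<sigma> T v"
  unfolding neural_operator_def
proof (intro ext sum.cong refl)
  fix t j k
  have "(\<Sum>l=1..dim_L T. weight T j k l * u (node T l)) = (\<Sum>l=1..dim_L T. weight T j k l * v (node T l))"
    using assms by (intro sum.cong) (auto simp: neural_coeffs_on_def)
  then show "alpha T j k * \<sigma> ((\<Sum>l=1..dim_L T. weight T j k l * u (node T l)) + theta T j k)
      * \<sigma> (direction T j \<bullet> t + zeta T j)
    = alpha T j k * \<sigma> ((\<Sum>l=1..dim_L T. weight T j k l * v (node T l)) + theta T j k)
      * \<sigma> (direction T j \<bullet> t + zeta T j)"
    by simp
qed

theorem theorem7p5:
  fixes \<Omega>\<^sub>X :: "(real ^ 'm) set" and \<Omega>\<^sub>Y :: "(real ^ 'n) set"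
    and \<sigma> :: "real \<Rightarrow> real"
    and D :: "(real ^ 'm \<Rightarrow> real) set"
    and F :: "(real ^ 'm \<Rightarrow> real) \<Rightarrow> (real ^ 'n \<Rightarrow> real)"
    and F' :: "(real ^ 'm \<Rightarrow> real) \<Rightarrow> (real ^ 'm \<Rightarrow> real) \<Rightarrow> (real ^ 'n \<Rightarrow> real)"
    and x\<^sub>0 x\<^sub>d :: "real ^ 'm \<Rightarrow> real" and y :: "real ^ 'n \<Rightarrow> real"
    and r L\<^sub>0 L\<^sub>1 \<xi>\<^sub>d :: real
  assumes "regular_bounded_domain \<Omega>\<^sub>X" and "regular_bounded_domain \<Omega>\<^sub>Y"
    and "sigmoid \<sigma>"
    and "L2_operator \<Omega>\<^sub>X \<Omega>\<^sub>Y D F"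
    and "x\<^sub>0 \<in> D" and "y \<in> L2 \<Omega>\<^sub>Y"
    and "minimum_norm_solution \<Omega>\<^sub>X \<Omega>\<^sub>Y D F y x\<^sub>0 x\<^sub>d"
    and "L2_ball \<Omega>\<^sub>X x\<^sub>d r \<subseteq> D" and "r > 2 * L2_dist \<Omega>\<^sub>X x\<^sub>d x\<^sub>0"
    and "L2_weakly_seq_closed \<Omega>\<^sub>X \<Omega>\<^sub>Y D F"
    and "L2_continuous_on \<Omega>\<^sub>X \<Omega>\<^sub>Y D F"
    and "\<forall>x\<in>L2_ball \<Omega>\<^sub>X x\<^sub>d r. L2_has_derivative \<Omega>\<^sub>X \<Omega>\<^sub>Y F (F' x) x"
    and "L\<^sub>1 > 0"
    and "\<forall>x\<in>L2_ball \<Omega>\<^sub>X x\<^sub>d r.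
           L2_onorm \<Omega>\<^sub>X \<Omega>\<^sub>Y (\<lambda>h t. F' x h t - F' x\<^sub>d h t) \<le> L\<^sub>1 * L2_dist \<Omega>\<^sub>X x x\<^sub>d"
    and "\<forall>\<xi>>0. mollify \<Omega>\<^sub>X \<xi> ` D \<subseteq> D"
    and "\<forall>\<xi>>0. compactin (mtopology_of (C_closure \<Omega>\<^sub>X)) (mollify_C \<Omega>\<^sub>X \<xi> ` D)"
    and "\<xi>\<^sub>d > 0"
    and "\<forall>\<xi>. 0 < \<xi> \<and> \<xi> \<le> \<xi>\<^sub>d \<longrightarrow> mollify \<Omega>\<^sub>X \<xi> x\<^sub>d \<in> L2_ball \<Omega>\<^sub>X x\<^sub>d (r / 2)"
    and "L\<^sub>0 = L2_onorm \<Omega>\<^sub>X \<Omega>\<^sub>Y (F' x\<^sub>d) + L\<^sub>1 * r"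
  shows "(\<forall>x\<in>L2_ball \<Omega>\<^sub>X x\<^sub>d r. \<forall>x'\<in>L2_ball \<Omega>\<^sub>X x\<^sub>d r.
            L2_dist \<Omega>\<^sub>Y (F x) (F x') \<le> L\<^sub>0 * L2_dist \<Omega>\<^sub>X x x') \<and>
         (\<forall>\<xi> \<epsilon>. 0 < \<xi> \<and> \<xi> \<le> \<xi>\<^sub>d \<and> 0 < \<epsilon> \<longrightarrow>
            (\<exists>n (T :: ('m, 'n) neural_coeffs).
               neural_coeffs_on \<Omega>\<^sub>X T \<and> neural_size T = n \<and>
               (\<forall>x\<in>L2_ball \<Omega>\<^sub>X x\<^sub>d (r / 2).
                  L2_dist \<Omega>\<^sub>Y (F x) (neural_operator \<sigma> T (mollify \<Omega>\<^sub>X \<xi> x))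
                    \<le> \<epsilon> + L\<^sub>0 * L2_dist \<Omega>\<^sub>X x (mollify \<Omega>\<^sub>X \<xi> x))))"
proof (intro conjI ballI allI impI)
  note X = regular_bounded_domainD[OF assms(1)]
  note F = assms(4) and ball_D = assms(8) and L\<^sub>0 = assms(19)
  have X_sets: "\<Omega>\<^sub>X \<in> sets lebesgue"
    using X(4) by (rule fmeasurableD)
  have xd: "x\<^sub>d \<in> D"
    using assms(7) by (simp add: minimum_norm_solution_def solution_def)
  have r: "0 < r"
    using assms(9) L2_dist_nonneg[of \<Omega>\<^sub>X x\<^sub>d x\<^sub>0] by linarith
  note xdL = L2_operator_onD(1)[OF F xd]
  have xd_ball: "x\<^sub>d \<in> L2_ball \<Omega>\<^sub>X x\<^sub>d r"
    using xdL r by (simp add: L2_ball_def L2_dist_refl)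
  have bl: "L2_bounded_linear \<Omega>\<^sub>X \<Omega>\<^sub>Y (F' z)" if "z \<in> L2_ball \<Omega>\<^sub>X x\<^sub>d r" for z
    using assms(12) that unfolding L2_has_derivative_def by blast
  \<comment> \<open>The origin of \<open>L\<^sub>0\<close>: the derivative at z differs from that at
    the center by at most \<open>L\<^sub>1\<close> times the distance, which is less than r.\<close>
  have bound: "L2_norm \<Omega>\<^sub>Y (F' z h) \<le> L\<^sub>0 * L2_norm \<Omega>\<^sub>X h" if z: "z \<in> L2_ball \<Omega>\<^sub>X x\<^sub>d r" and h: "h \<in> L2 \<Omega>\<^sub>X" for z h
  proof -
    have "L2_onorm \<Omega>\<^sub>X \<Omega>\<^sub>Y (\<lambda>h t. F' z h t - F' x\<^sub>d h t) \<le> L\<^sub>1 * L2_dist \<Omega>\<^sub>X z x\<^sub>d"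
      using assms(14) z by blast
    also have "\<dots> \<le> L\<^sub>1 * r"
      using z assms(13) by (intro mult_left_mono) (auto simp: L2_ball_def)
    finally have "L2_onorm \<Omega>\<^sub>X \<Omega>\<^sub>Y (F' x\<^sub>d) + L2_onorm \<Omega>\<^sub>X \<Omega>\<^sub>Y (\<lambda>h t. F' z h t - F' x\<^sub>d h t) \<le> L\<^sub>0"
      by (simp add: L\<^sub>0)
    from L2_norm_le_onorm_diff[OF bl[OF z] bl[OF xd_ball] h] mult_right_mono[OF this L2_norm_nonneg]
    show ?thesis
      by (rule order_trans)
  qed
  have lip: "L2_dist \<Omega>\<^sub>Y (F x) (F x') \<le> L\<^sub>0 * L2_dist \<Omega>\<^sub>X x x'"
    if "x \<in> L2_ball \<Omega>\<^sub>X x\<^sub>d r" "x' \<in> L2_ball \<Omega>\<^sub>X x\<^sub>d r" for x x'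
  proof (rule L2_mean_value_bound[OF _ _ bound that xdL])
    show "F z \<in> L2 \<Omega>\<^sub>Y" if "z \<in> L2_ball \<Omega>\<^sub>X x\<^sub>d r" for z
      using L2_operator_onD(2)[OF F] ball_D that by blast
    show "L2_has_derivative \<Omega>\<^sub>X \<Omega>\<^sub>Y F (F' z) z" if "z \<in> L2_ball \<Omega>\<^sub>X x\<^sub>d r" for z
      using assms(12) that by blast
  qed
  show "L2_dist \<Omega>\<^sub>Y (F x) (F x') \<le> L\<^sub>0 * L2_dist \<Omega>\<^sub>X x x'"
    if "x \<in> L2_ball \<Omega>\<^sub>X x\<^sub>d r" "x' \<in> L2_ball \<Omega>\<^sub>X x\<^sub>d r" for x x'
    using that by (rule lip)
  fix \<xi> \<epsilon> :: real
  assume "0 < \<xi> \<and> \<xi> \<le> \<xi>\<^sub>d \<and> 0 < \<epsilon>"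
  then have \<xi>: "0 < \<xi>" "\<xi> \<le> \<xi>\<^sub>d" and \<epsilon>: "0 < \<epsilon>"
    by auto
  have moll_D: "mollify \<Omega>\<^sub>X \<xi> x \<in> D" if "x \<in> D" for x
    using assms(15) \<xi>(1) that by blast
  have moll_C_L2: "mollify_C \<Omega>\<^sub>X \<xi> x \<in> L2 \<Omega>\<^sub>X" if "x \<in> D" for x
    by (rule L2_cong_on[OF L2_operator_onD(1)[OF F moll_D[OF that]] mollify_C_eq_on])
  \<comment> \<open>D is closed under equality in L^2, and the restriction changes the function only
    outside the domain.\<close>
  have moll_C_D: "mollify_C \<Omega>\<^sub>X \<xi> x \<in> D" if "x \<in> D" for x
    using F moll_D[OF that] moll_C_L2[OF that] L2_eq_mollify_C[OF X_sets]
    unfolding L2_operator_def L2_subset_def by blast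
  have compact: "compactin (mtopology_of (C_closure \<Omega>\<^sub>X)) (mollify_C \<Omega>\<^sub>X \<xi> ` D)"
    using assms(16) \<xi>(1) by blast
  have "mollify_C \<Omega>\<^sub>X \<xi> ` D \<subseteq> D"
    using moll_C_D by blast
  from neural_operator_approximation[OF assms(3,1,2) F assms(11) compact this \<epsilon>]
  obtain T :: "('m, 'n) neural_coeffs" where T: "neural_coeffs_on \<Omega>\<^sub>X T"
    and approx: "\<And>u. u \<in> mollify_C \<Omega>\<^sub>X \<xi> ` D \<Longrightarrow>
      neural_operator \<sigma> T u \<in> L2 \<Omega>\<^sub>Y \<and> L2_dist \<Omega>\<^sub>Y (F u) (neural_operator \<sigma> T u) \<le> \<epsilon>"
    by blast
  have "L2_dist \<Omega>\<^sub>Y (F x) (neural_operator \<sigma> T (mollify \<Omega>\<^sub>X \<xi> x))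
      \<le> \<epsilon> + L\<^sub>0 * L2_dist \<Omega>\<^sub>X x (mollify \<Omega>\<^sub>X \<xi> x)" if x: "x \<in> L2_ball \<Omega>\<^sub>X x\<^sub>d (r / 2)" for x
  proof -
    let ?u = "mollify \<Omega>\<^sub>X \<xi> x" and ?v = "mollify_C \<Omega>\<^sub>X \<xi> x"
    have x_ball: "x \<in> L2_ball \<Omega>\<^sub>X x\<^sub>d r"
      using x r by (simp add: L2_ball_def)
    then have xD: "x \<in> D"
      using ball_D by blast
    have uL: "?u \<in> L2 \<Omega>\<^sub>X" "mollify \<Omega>\<^sub>X \<xi> x\<^sub>d \<in> L2 \<Omega>\<^sub>X"
      using L2_operator_onD(1)[OF F] moll_D xD xd by blast+
    \<comment> \<open>Two steps of length r / 2 reach the ball of radius r: by contraction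
      \<open>?u\<close> is close to the mollified center, and the choice of
      \<open>\<xi>\<^sub>d\<close> keeps that close to the center.\<close>
    have "L2_dist \<Omega>\<^sub>X ?u x\<^sub>d \<le> L2_dist \<Omega>\<^sub>X ?u (mollify \<Omega>\<^sub>X \<xi> x\<^sub>d) + L2_dist \<Omega>\<^sub>X (mollify \<Omega>\<^sub>X \<xi> x\<^sub>d) x\<^sub>d"
      using uL xdL by (rule L2_dist_triangle)
    also have "\<dots> < r / 2 + r / 2"
    proof (rule add_strict_mono)
      show "L2_dist \<Omega>\<^sub>X ?u (mollify \<Omega>\<^sub>X \<xi> x\<^sub>d) < r / 2"
        using L2_dist_mollify_le[OF \<xi>(1) L2_operator_onD(1)[OF F xD] xdL X(4)] x
        by (simp add: L2_ball_def)
      show "L2_dist \<Omega>\<^sub>X (mollify \<Omega>\<^sub>X \<xi> x\<^sub>d) x\<^sub>d < r / 2"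
        using assms(18) \<xi> by (simp add: L2_ball_def)
    qed
    finally have u_ball: "?u \<in> L2_ball \<Omega>\<^sub>X x\<^sub>d r"
      using uL by (simp add: L2_ball_def)
    \<comment> \<open>Approximation is available at the element \<open>?v\<close> of the compact
      set; F and the network take it over to \<open>?u\<close>, the former almost everywhere, the
      latter exactly.\<close>
    have eq: "L2_eq \<Omega>\<^sub>Y (F ?u) (F ?v)"
      using F moll_D[OF xD] moll_C_D[OF xD] L2_eq_mollify_C[OF X_sets]
      unfolding L2_operator_def by blast
    have op: "neural_operator \<sigma> T ?u = neural_operator \<sigma> T ?v"
      by (rule neural_operator_cong[OF T]) (simp add: mollify_C_eq_on)
    have FL: "F x \<in> L2 \<Omega>\<^sub>Y" "F ?u \<in> L2 \<Omega>\<^sub>Y" "F ?v \<in> L2 \<Omega>\<^sub>Y"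
      using L2_operator_onD(2)[OF F] xD moll_D[OF xD] moll_C_D[OF xD] by blast+
    have NL: "neural_operator \<sigma> T ?v \<in> L2 \<Omega>\<^sub>Y" "L2_dist \<Omega>\<^sub>Y (F ?v) (neural_operator \<sigma> T ?v) \<le> \<epsilon>"
      using approx xD by blast+
    have "L2_dist \<Omega>\<^sub>Y (F ?u) (neural_operator \<sigma> T ?v) = L2_dist \<Omega>\<^sub>Y (F ?v) (neural_operator \<sigma> T ?v)"
      using eq FL NL by (intro L2_dist_cong_AE) (auto simp: L2_eq_def)
    then have "L2_dist \<Omega>\<^sub>Y (F x) (neural_operator \<sigma> T ?v) \<le> L2_dist \<Omega>\<^sub>Y (F x) (F ?u) + \<epsilon>"
      using L2_dist_triangle[OF FL(1,2) NL(1)] NL(2) by linarith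
    then show ?thesis
      using lip[OF x_ball u_ball] by (simp add: op)
  qed
  then show "\<exists>n (T :: ('m, 'n) neural_coeffs). neural_coeffs_on \<Omega>\<^sub>X T \<and> neural_size T = n \<and>
      (\<forall>x\<in>L2_ball \<Omega>\<^sub>X x\<^sub>d (r / 2). L2_dist \<Omega>\<^sub>Y (F x) (neural_operator \<sigma> T (mollify \<Omega>\<^sub>X \<xi> x))
        \<le> \<epsilon> + L\<^sub>0 * L2_dist \<Omega>\<^sub>X x (mollify \<Omega>\<^sub>X \<xi> x))"
    using T by blast
qed

end
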